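(* There exist a locally finite tree with fins $\mathbf{X}$ and free uniform lattices $\Gamma,\Gamma'\leq\operatorname{Aut}(\mathbf{X})$ such that no uniform lattice $\Lambda\leq\operatorname{Aut}(\mathbf{X})$ contains both an $\operatorname{Aut}(\mathbf{X})$-conjugate of $\Gamma$ and an $\operatorname{Aut}(\mathbf{X})$-conjugate of $\Gamma'$.
   Context: Tree with fins: let $X$ be a tree (a 1-dimensional cell complex) and let $\Delta$ be a collection of (combinatorial, i.e. vertex-to-vertex and edge-to-edge) embeddings of trees $\gamma:Y\to X$ (the tree $Y$ may vary with $\gamma$). The associated tree with fins $\mathbf{X}$ is the CAT(0) square complex given by the mapping cylinder of $\bigcup_\Delta\gamma:\bigsqcup_\Delta Y\to X$, i.e. as a space $$\mathbf{X}=\Big(X\sqcup\bigsqcup_{\Delta}Y\times[0,1]\Big)/\sim,\qquad (y,0)\sim\gamma(y)\ \text{ for } y\in Y,\ (\gamma:Y\to X)\in\Delta,$$ where the squares come from the subspaces $e\times[0,1]$ for edges $e$ of $Y$. The tree $X$ is regarded as a subcomplex of $\mathbf{X}$ (the underlying tree), and each subcomplex $Y\times\{1\}$ is called a fin. $\mathbf{X}$ is locally finite if it is a locally finite square complex. For $\mathbf{X}$ a locally finite tree with fins, $\operatorname{Aut}(\mathbf{X})$ is the group of all cubical automorphisms of $\mathbf{X}$ that preserve the underlying tree $X\subset\mathbf{X}$, with the compact-open topology. A subgroup $\Gamma\leq\operatorname{Aut}(\mathbf{X})$ is a uniform lattice if $\Gamma$ acts properly and cocompactly on $\mathbf{X}$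 (equivalently, the action on the vertices of $\mathbf{X}$ has finite stabilisers and finitely many orbits). A uniform lattice is free if it acts freely on $\mathbf{X}$ (no non-trivial element fixes a point of $\mathbf{X}$). *)

theory Defs
  imports "HOL-Analysis.Analysis" "HOL-Algebra.Bij" "HOL-Algebra.Coset"
begin

section \<open>Graphs and trees\<close>

record 'v cell_graph =
  verts :: "'v set"
  edges :: "'v set set"

definition is_graph :: "'v cell_graph \<Rightarrow> bool" where
  "is_graph G \<longleftrightarrow> (\<forall>e\<in>edges G. e \<subseteq> verts G \<and> card e = 2)"

definition is_walk :: "'v cell_graph \<Rightarrow> 'v list \<Rightarrow> bool" where
  "is_walk G xs \<longleftrightarrow> xs \<noteq> [] \<and> set xs \<subseteq> verts G \<and>
     (\<forall>i. Suc i < length xs \<longrightarrow> {xs ! i, xs ! Suc i} \<in> edges G)"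

definition is_cycle :: "'v cell_graph \<Rightarrow> 'v list \<Rightarrow> bool" where
  "is_cycle G xs \<longleftrightarrow> is_walk G xs \<and> distinct xs \<and> 3 \<le> length xs \<and> {last xs, hd xs} \<in> edges G"

definition is_tree :: "'v cell_graph \<Rightarrow> bool" where
  "is_tree G \<longleftrightarrow> is_graph G \<and> verts G \<noteq> {} \<and>
     (\<forall>u\<in>verts G. \<forall>v\<in>verts G. \<exists>xs. is_walk G xs \<and> hd xs = u \<and> last xs = v) \<and>
     (\<nexists>xs. is_cycle G xs)"

definition graph_embedding :: "'w cell_graph \<Rightarrow> 'v cell_graph \<Rightarrow> ('w \<Rightarrow> 'v) \<Rightarrow> bool" where
  "graph_embedding H G f \<longleftrightarrow>
     inj_on f (verts H) \<and> f ` verts H \<subseteq> verts G \<and> (\<forall>e\<in>edges H. f ` e \<in> edges G)"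

text \<open>
  The geometric realisation of a graph, in barycentric coordinates: a point is a
  weight function supported on a vertex or on an edge.
\<close>

definition graph_points :: "'v cell_graph \<Rightarrow> ('v \<Rightarrow> real) set" where
  "graph_points G =
     {p. \<exists>c \<in> (\<lambda>v. {v}) ` verts G \<union> edges G.
           (\<forall>v. 0 \<le> p v) \<and> (\<forall>v. v \<notin> c \<longrightarrow> p v = 0) \<and> (\<Sum>v\<in>c. p v) = 1}"


section \<open>Square complexes and their automorphisms\<close>

text \<open>
  Edges and squares are recorded as their sets of vertices. The square complexes below have
  no two cells with the same vertex set, and no two vertices of a square are joined by an edge
  unless that edge is a side of the square, so no information is lost.
\<close>

record 'v square_complex = "'v cell_graph" +
  squares :: "'v set set"

definition locally_finite :: "'v square_complex \<Rightarrow> bool" where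
  "locally_finite Q \<longleftrightarrow> (\<forall>v\<in>verts Q. finite {c \<in> edges Q \<union> squares Q. v \<in> c})"

definition cubical_automorphisms :: "'v square_complex \<Rightarrow> ('v \<Rightarrow> 'v) set" where
  "cubical_automorphisms Q =
     {f \<in> Bij (verts Q). (`) f ` edges Q = edges Q \<and> (`) f ` squares Q = squares Q}"


section \<open>Trees with fins\<close>

text \<open>
  The collection of embeddings is an indexed family \<open>fin_map X i\<close>,
  \<open>i \<in> fin_index X\<close>, with domains the trees \<open>fin_tree X i\<close>.
\<close>

record ('v, 'i, 'y) fin_data =
  base_tree :: "'v cell_graph"
  fin_index :: "'i set"
  fin_tree :: "'i \<Rightarrow> 'y cell_graph"
  fin_map :: "'i \<Rightarrow> 'y \<Rightarrow> 'v"

definition tree_with_fins :: "('v, 'i, 'y) fin_data \<Rightarrow> bool" where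
  "tree_with_fins X \<longleftrightarrow> is_tree (base_tree X) \<and>
     (\<forall>i\<in>fin_index X. is_tree (fin_tree X i) \<and>
        graph_embedding (fin_tree X i) (base_tree X) (fin_map X i))"

text \<open>\<open>Fin i y\<close> is the point \<open>(y, 1)\<close> of the fin with index \<open>i\<close>.\<close>

datatype ('v, 'i, 'y) fin_vertex = Base 'v | Fin 'i 'y

definition mapping_cylinder ::
    "('v, 'i, 'y) fin_data \<Rightarrow> ('v, 'i, 'y) fin_vertex square_complex" where
  "mapping_cylinder X =
    \<lparr>verts = Base ` verts (base_tree X) \<union>
        {Fin i y |i y. i \<in> fin_index X \<and> y \<in> verts (fin_tree X i)},
     edges = (`) Base ` edges (base_tree X) \<union>
        {Fin i ` e |i e. i \<in> fin_index X \<and> e \<in> edges (fin_tree X i)} \<union>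
        {{Base (fin_map X i y), Fin i y} |i y. i \<in> fin_index X \<and> y \<in> verts (fin_tree X i)},
     squares =
        {Base ` fin_map X i ` e \<union> Fin i ` e |i e. i \<in> fin_index X \<and> e \<in> edges (fin_tree X i)}\<rparr>"

definition underlying_tree ::
    "('v, 'i, 'y) fin_data \<Rightarrow> ('v, 'i, 'y) fin_vertex cell_graph" where
  "underlying_tree X =
    \<lparr>verts = Base ` verts (base_tree X), edges = (`) Base ` edges (base_tree X)\<rparr>"

definition fin_auts ::
    "('v, 'i, 'y) fin_data \<Rightarrow> (('v, 'i, 'y) fin_vertex \<Rightarrow> ('v, 'i, 'y) fin_vertex) set" where
  "fin_auts X =
     {f \<in> cubical_automorphisms (mapping_cylinder X).
        f ` verts (underlying_tree X) = verts (underlying_tree X) \<and>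
        (`) f ` edges (underlying_tree X) = edges (underlying_tree X)}"

definition Aut ::
    "('v, 'i, 'y) fin_data \<Rightarrow> (('v, 'i, 'y) fin_vertex \<Rightarrow> ('v, 'i, 'y) fin_vertex) monoid" where
  "Aut X = (BijGroup (verts (mapping_cylinder X)))\<lparr>carrier := fin_auts X\<rparr>"


lemma stab_subgroup:
  assumes "A \<subseteq> Pow S" shows "subgroup {f \<in> Bij S. (`) f ` A = A} (BijGroup S)"
proof -
  interpret group "BijGroup S" by (rule group_BijGroup)
  have comp: "(`) (compose S g f) ` A = (`) g ` (`) f ` A" for g f :: "'a \<Rightarrow> 'a"
  proof -
    have "compose S g f ` e = g ` f ` e" if "e \<in> A" for e
      using that assms unfolding image_image by (intro image_cong) (auto simp: compose_def)
    then have "(`) (compose S g f) ` A = (\<lambda>e. g ` f ` e) ` A" by (rule image_cong[OF refl])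
    then show ?thesis by (simp only: image_image)
  qed
  have idA: "(`) (\<lambda>x\<in>S. x) ` A = A"
  proof -
    have "(\<lambda>x\<in>S. x) ` e = id e" if "e \<in> A" for e
      using that assms by auto
    then have "(`) (\<lambda>x\<in>S. x) ` A = id ` A" by (intro image_cong) auto
    then show ?thesis by simp
  qed
  show ?thesis
  proof
    show "{f \<in> Bij S. (`) f ` A = A} \<subseteq> carrier (BijGroup S)" by (auto simp: BijGroup_def)
    show "\<one>\<^bsub>BijGroup S\<^esub> \<in> {f \<in> Bij S. (`) f ` A = A}"
      using idA by (simp add: BijGroup_def id_Bij)
    fix f assume f: "f \<in> {f \<in> Bij S. (`) f ` A = A}"
    { fix g assume "g \<in> {f \<in> Bij S. (`) f ` A = A}"
      with f show "f \<otimes>\<^bsub>BijGroup S\<^esub> g \<in> {f \<in> Bij S. (`) f ` A = A}"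
        by (simp add: BijGroup_def compose_Bij comp) }
    define h where "h = inv\<^bsub>BijGroup S\<^esub> f"
    have fB: "f \<in> Bij S" and fA: "(`) f ` A = A" using f by blast+
    then have fc: "f \<in> carrier (BijGroup S)" by (simp add: BijGroup_def)
    then have hB: "h \<in> Bij S" using inv_closed unfolding h_def by (simp add: BijGroup_def)
    have "h \<otimes>\<^bsub>BijGroup S\<^esub> f = \<one>\<^bsub>BijGroup S\<^esub>"
      unfolding h_def by (rule l_inv[OF fc])
    then have "compose S h f = (\<lambda>x\<in>S. x)"
      using hB fB by (simp add: BijGroup_def)
    then have "(`) h ` A = A" by (metis comp idA fA)
    with hB show "inv\<^bsub>BijGroup S\<^esub> f \<in> {f \<in> Bij S. (`) f ` A = A}"
      unfolding h_def by blast
  qed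
qed

lemma group_Aut:
  assumes "tree_with_fins X"
  shows "group (Aut X)"
proof -
  let ?S = "verts (mapping_cylinder X)"
  let ?st = "\<lambda>A. {f \<in> Bij ?S. (`) f ` A = A}"
  interpret group "BijGroup ?S" by (rule group_BijGroup)
  have fe: "fin_map X i y \<in> verts (base_tree X)" if "i \<in> fin_index X" "y \<in> verts (fin_tree X i)" for i y
    using assms that by (auto simp: tree_with_fins_def graph_embedding_def)
  have ee: "y \<in> verts (fin_tree X i)" if "i \<in> fin_index X" "e \<in> edges (fin_tree X i)" "y \<in> e" for i y e
    using assms that unfolding tree_with_fins_def is_tree_def is_graph_def by blast
  have be: "y \<in> verts (base_tree X)" if "e \<in> edges (base_tree X)" "y \<in> e" for y e
    using assms that unfolding tree_with_fins_def is_tree_def is_graph_def by blast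
  have emb: "fin_map X i y \<in> verts (base_tree X)"
    if "i \<in> fin_index X" "e \<in> edges (fin_tree X i)" "y \<in> e" for i y e
    using fe ee that by blast
  have "edges (mapping_cylinder X) \<subseteq> Pow ?S"
    unfolding mapping_cylinder_def by (auto intro: fe ee be)
  moreover have "squares (mapping_cylinder X) \<subseteq> Pow ?S"
    unfolding mapping_cylinder_def by (auto intro: emb ee)
  moreover have "{verts (underlying_tree X)} \<subseteq> Pow ?S"
    unfolding mapping_cylinder_def underlying_tree_def by auto
  moreover have "edges (underlying_tree X) \<subseteq> Pow ?S"
    unfolding mapping_cylinder_def underlying_tree_def by (auto intro: be)
  ultimately have sub: "edges (mapping_cylinder X) \<subseteq> Pow ?S" "squares (mapping_cylinder X) \<subseteq> Pow ?S"
    "{verts (underlying_tree X)} \<subseteq> Pow ?S" "edges (underlying_tree X) \<subseteq> Pow ?S"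
    by blast+
  have eq: "fin_auts X = (?st (edges (mapping_cylinder X)) \<inter> ?st (squares (mapping_cylinder X)))
    \<inter> (?st {verts (underlying_tree X)} \<inter> ?st (edges (underlying_tree X)))"
    by (auto simp: fin_auts_def cubical_automorphisms_def)
  have "subgroup (fin_auts X) (BijGroup ?S)"
    unfolding eq using sub by (intro subgroups_Inter_pair stab_subgroup)
  then show ?thesis
    unfolding Aut_def by (rule subgroup_imp_group)
qed


section \<open>The geometric realisation\<close>

text \<open>
  A point of the mapping cylinder is again encoded by its weights on the vertices. The point
  represented by \<open>(q, t)\<close> in \<open>Y \<times> [0,1]\<close> has weight \<open>(1 - t) q(y)\<close> on \<open>Base (\<gamma> y)\<close>
  and \<open>t q(y)\<close> on \<open>Fin i y\<close>. Since \<open>\<gamma>\<close> is injective these weights determine \<open>(q, t)\<close> when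
  \<open>t > 0\<close>, and for \<open>t = 0\<close> they are those of \<open>\<gamma>(q)\<close>; so exactly the identifications
  \<open>(q, 0) \<sim> \<gamma>(q)\<close> are made.
  For a locally finite complex the subspace topology from the product topology on weight functions
  agrees with the cell complex topology: the set where the weight of a given vertex is positive
  is an open neighbourhood of that vertex in both, and it lies in a finite subcomplex.
\<close>

definition base_point :: "('v \<Rightarrow> real) \<Rightarrow> ('v, 'i, 'y) fin_vertex \<Rightarrow> real" where
  "base_point p z = (case z of Base v \<Rightarrow> p v | Fin i y \<Rightarrow> 0)"

definition cylinder_point ::
    "('v, 'i, 'y) fin_data \<Rightarrow> 'i \<Rightarrow> ('y \<Rightarrow> real) \<Rightarrow> real \<Rightarrow> ('v, 'i, 'y) fin_vertex \<Rightarrow> real" where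
  "cylinder_point X i q t z =
     (case z of
        Base v \<Rightarrow> (1 - t) * (\<Sum>y | y \<in> verts (fin_tree X i) \<and> fin_map X i y = v. q y)
      | Fin j y \<Rightarrow> if j = i then t * q y else 0)"

definition points :: "('v, 'i, 'y) fin_data \<Rightarrow> (('v, 'i, 'y) fin_vertex \<Rightarrow> real) set" where
  "points X = base_point ` graph_points (base_tree X) \<union>
     {cylinder_point X i q t |i q t.
        i \<in> fin_index X \<and> q \<in> graph_points (fin_tree X i) \<and> 0 \<le> t \<and> t \<le> 1}"

text \<open>The action on points pushes weights forward, i.e. extends the action on vertices
  multilinearly over each cell.\<close>

definition act ::
    "('v, 'i, 'y) fin_data \<Rightarrow> (('v, 'i, 'y) fin_vertex \<Rightarrow> ('v, 'i, 'y) fin_vertex) \<Rightarrow>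
     (('v, 'i, 'y) fin_vertex \<Rightarrow> real) \<Rightarrow> (('v, 'i, 'y) fin_vertex \<Rightarrow> real)" where
  "act X g p z =
     (if z \<in> verts (mapping_cylinder X) then p (inv_into (verts (mapping_cylinder X)) g z) else 0)"


section \<open>Uniform lattices\<close>

definition acts_properly ::
    "('v, 'i, 'y) fin_data \<Rightarrow> (('v, 'i, 'y) fin_vertex \<Rightarrow> ('v, 'i, 'y) fin_vertex) set \<Rightarrow> bool" where
  "acts_properly X \<Gamma> \<longleftrightarrow>
     (\<forall>K. K \<subseteq> points X \<and> compact K \<longrightarrow> finite {g \<in> \<Gamma>. act X g ` K \<inter> K \<noteq> {}})"

definition acts_cocompactly ::
    "('v, 'i, 'y) fin_data \<Rightarrow> (('v, 'i, 'y) fin_vertex \<Rightarrow> ('v, 'i, 'y) fin_vertex) set \<Rightarrow> bool" where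
  "acts_cocompactly X \<Gamma> \<longleftrightarrow>
     (\<exists>K. K \<subseteq> points X \<and> compact K \<and> (\<Union>g\<in>\<Gamma>. act X g ` K) = points X)"

definition acts_freely ::
    "('v, 'i, 'y) fin_data \<Rightarrow> (('v, 'i, 'y) fin_vertex \<Rightarrow> ('v, 'i, 'y) fin_vertex) set \<Rightarrow> bool" where
  "acts_freely X \<Gamma> \<longleftrightarrow> (\<forall>g\<in>\<Gamma>. (\<exists>p\<in>points X. act X g p = p) \<longrightarrow> g = \<one>\<^bsub>Aut X\<^esub>)"

definition uniform_lattice ::
    "('v, 'i, 'y) fin_data \<Rightarrow> (('v, 'i, 'y) fin_vertex \<Rightarrow> ('v, 'i, 'y) fin_vertex) set \<Rightarrow> bool" where
  "uniform_lattice X \<Gamma> \<longleftrightarrow>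
     subgroup \<Gamma> (Aut X) \<and> acts_properly X \<Gamma> \<and> acts_cocompactly X \<Gamma>"

definition free_uniform_lattice ::
    "('v, 'i, 'y) fin_data \<Rightarrow> (('v, 'i, 'y) fin_vertex \<Rightarrow> ('v, 'i, 'y) fin_vertex) set \<Rightarrow> bool" where
  "free_uniform_lattice X \<Gamma> \<longleftrightarrow> uniform_lattice X \<Gamma> \<and> acts_freely X \<Gamma>"

definition contains_conjugate :: "('g, 'b) monoid_scheme \<Rightarrow> 'g set \<Rightarrow> 'g set \<Rightarrow> bool" where
  "contains_conjugate G \<Lambda> \<Gamma> \<longleftrightarrow>
     (\<exists>g\<in>carrier G. (g <#\<^bsub>G\<^esub> \<Gamma>) #>\<^bsub>G\<^esub> (inv\<^bsub>G\<^esub> g) \<subseteq> \<Lambda>)"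

end

theory Submission
  imports Defs
begin

text \<open>
  The base tree is the Cayley tree of the free group on two generators. Edges are oriented, so every
  vertex \<open>v\<close> has two out-neighbours \<open>v0\<close>, \<open>v1\<close> and two in-neighbours. For an automorphism
  \<open>g\<close> that respects the orientation let \<open>\<sigma>(g, v) \<in> \<int>/2\<close> record whether \<open>g\<close> exchanges the
  labels of the two out-edges at \<open>v\<close>, and call
  \<open>\<sigma>(g, v) + \<sigma>(g, v0) + \<sigma>(g, v1)\<close> the defect of \<open>g\<close> at \<open>v\<close>. The fins are finite subtrees,
  chosen such that the automorphisms of the tree with fins are exactly the extensions of the
  orientation preserving \<open>g\<close> of zero defect (\<open>F2_symmetries_iff\<close>).

  If such a \<open>g\<close> fixes \<open>v\<close> and \<open>\<sigma>(g, v) = 1\<close>, then \<open>g\<^sup>2\<close> fixes \<open>v0\<close> and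
  \<open>\<sigma>(g\<^sup>2, v0) = \<sigma>(g, v0) + \<sigma>(g, v1) = 1\<close>. This repeats with \<open>g\<^sup>2\<close> and \<open>v0\<close>, so \<open>g\<close>
  is an odometer and has infinite order (\<open>odd_elliptic_infinite_order\<close>). Vertex stabilisers in a
  uniform lattice are finite; hence \<open>\<sigma>(g, v) = 0\<close> whenever \<open>g\<close> lies in a uniform lattice and
  fixes \<open>v\<close> (\<open>lattice_elliptic_even\<close>).

  One lattice consists of the left translations of the free group. They have \<open>\<sigma> = 0\<close> and are
  transitive on the vertices. For the other one, colour the vertices by the homomorphism to
  \<open>\<int>/3\<close> that sends the generators to 1 and 2; then \<open>v\<close>, \<open>v0\<close> and \<open>v1\<close> always have three
  different colours. There is an orientation preserving automorphism \<open>h\<close> of the tree (\<open>twist\<close>)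
  that has defect 1 at the vertices of colour 0 and defect 0 elsewhere. The conjugates by
  \<open>h\<close> of the colour preserving translations have zero defect, although \<open>h\<close> does not,
  and they form a lattice with three orbits of vertices.

  Suppose that a uniform lattice \<open>\<Lambda>\<close> contains conjugates of both, by some \<open>c\<close> and by \<open>c'\<close>
  respectively. Then \<open>\<Lambda>\<close> is transitive on vertices, and as \<open>\<sigma>\<close> vanishes on its stabilisers,
  \<open>s(m o) = \<sigma>(m, o)\<close> for \<open>m \<in> \<Lambda>\<close> and a base vertex \<open>o\<close> defines a function on the vertices.
  By transitivity \<open>s(v) + s(v0) + s(v1)\<close> is constant. Let \<open>H = c' h\<close>. The function
  \<open>f(v) = s(H v) + \<sigma>(H, v)\<close> is invariant under colour preserving translations and therefore
  depends only on the colour of \<open>v\<close>. So \<open>f(v) + f(v0) + f(v1)\<close>, the sum over the three colours, is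
  the same for all \<open>v\<close>. But it also equals the constant plus the defect of \<open>H\<close> at \<open>v\<close>, and
  that defect is not constant (\<open>no_common_overgroup\<close>).
\<close>


section \<open>Graphs and trees\<close>

definition adjacency :: "'v cell_graph \<Rightarrow> ('v \<times> 'v) set" where
  "adjacency G = {(u, v). {u, v} \<in> edges G}"

lemma sym_adjacency: "sym (adjacency G)"
  by (auto simp: sym_def adjacency_def insert_commute)

lemma edge_verts: "is_graph G \<Longrightarrow> {u, v} \<in> edges G \<Longrightarrow> u \<in> verts G \<and> v \<in> verts G \<and> u \<noteq> v"
  unfolding is_graph_def by (metis card_2_iff doubleton_eq_iff insert_subset insert_absorb2)

lemma is_walk_single [simp]: "is_walk G [x] \<longleftrightarrow> x \<in> verts G"
  by (simp add: is_walk_def)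

lemma is_walk_Cons:
  "is_walk G (x # y # ys) \<longleftrightarrow> x \<in> verts G \<and> {x, y} \<in> edges G \<and> is_walk G (y # ys)"
proof -
  have "(\<forall>i. Suc i < length (x # y # ys) \<longrightarrow> {(x # y # ys) ! i, (x # y # ys) ! Suc i} \<in> edges G)
    \<longleftrightarrow> {x, y} \<in> edges G \<and>
      (\<forall>i. Suc i < length (y # ys) \<longrightarrow> {(y # ys) ! i, (y # ys) ! Suc i} \<in> edges G)"
    (is "(\<forall>i. ?P i) \<longleftrightarrow> _ \<and> (\<forall>i. ?Q i)")
  proof -
    have "?P 0 \<longleftrightarrow> {x, y} \<in> edges G" "\<And>i. ?P (Suc i) \<longleftrightarrow> ?Q i" by simp_all
    then show ?thesis by (metis not0_implies_Suc)
  qed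
  then show ?thesis unfolding is_walk_def by auto
qed

lemma rtrancl_walk:
  assumes "(u, v) \<in> (adjacency G)\<^sup>*" "is_graph G" "v \<in> verts G"
  shows "\<exists>xs. is_walk G xs \<and> hd xs = u \<and> last xs = v"
  using assms(1)
proof (induction rule: converse_rtrancl_induct)
  case base
  show ?case using assms(3) by (intro exI[of _ "[v]"]) simp
next
  case (step x y)
  then obtain xs where xs: "is_walk G xs" "hd xs = y" "last xs = v" by blast
  then obtain ys where ys: "xs = y # ys" by (cases xs) (auto simp: is_walk_def)
  have "{x, y} \<in> edges G" using step(1) by (simp add: adjacency_def)
  then have "is_walk G (x # y # ys)"
    using xs(1) edge_verts[OF assms(2)] unfolding ys is_walk_Cons by blast
  then show ?case using xs(3) ys by (intro exI[of _ "x # y # ys"]) auto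
qed

lemma is_cycle_nth:
  assumes "is_cycle G xs" "i < length xs"
  shows "{xs ! i, xs ! (Suc i mod length xs)} \<in> edges G"
proof (cases "Suc i = length xs")
  case True
  have "xs \<noteq> []" using assms by auto
  then have "last xs = xs ! i" "hd xs = xs ! (Suc i mod length xs)"
    using True by (simp_all add: last_conv_nth hd_conv_nth flip: True)
  then show ?thesis using assms(1) by (simp add: is_cycle_def)
next
  case False
  then show ?thesis using assms by (simp add: is_cycle_def is_walk_def)
qed

text \<open>
  A vertex of maximal depth on a cycle would have two different neighbours on the cycle, and both of
  them would be its parent.
\<close>

lemma no_cycle_by_depth:
  fixes depth :: "'v \<Rightarrow> nat"
  assumes par: "\<And>u v. {u, v} \<in> edges G \<Longrightarrow> depth u \<le> depth v \<Longrightarrow> u = par v"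
  shows "\<not> is_cycle G xs"
proof
  assume cyc: "is_cycle G xs"
  let ?n = "length xs"
  have n: "3 \<le> ?n" and dist: "distinct xs" using cyc by (auto simp: is_cycle_def)
  have "finite ((\<lambda>i. depth (xs ! i)) ` {..<?n})" "(\<lambda>i. depth (xs ! i)) ` {..<?n} \<noteq> {}"
    using n by (auto simp: lessThan_empty_iff)
  note max_ex = Max_in[OF this] Max_ge[OF this(1)]
  from max_ex(1) obtain i where i: "i < ?n"
    and eq: "Max ((\<lambda>i. depth (xs ! i)) ` {..<?n}) = depth (xs ! i)"
    by auto
  have max: "depth (xs ! j) \<le> depth (xs ! i)" if "j < ?n" for j
    using max_ex(2)[of "depth (xs ! j)"] that unfolding eq by blast
  define j where "j = Suc i mod ?n"
  define k where "k = (if i = 0 then ?n - 1 else i - 1)"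
  have "0 < ?n" using n by linarith
  then have jn: "j < ?n" unfolding j_def by (rule mod_less_divisor)
  have kn: "k < ?n" using n i by (auto simp: k_def)
  have ki: "Suc k mod ?n = i" using n i by (auto simp: k_def)
  have jk: "j \<noteq> k"
  proof (cases "Suc i = ?n")
    case True
    then show ?thesis using n by (auto simp: j_def k_def split: if_splits)
  next
    case False
    then have "j = Suc i" using i by (simp add: j_def)
    then show ?thesis using n i False by (auto simp: k_def split: if_splits)
  qed
  have "{xs ! j, xs ! i} \<in> edges G"
    using is_cycle_nth[OF cyc i] by (simp add: j_def insert_commute)
  moreover have "{xs ! k, xs ! i} \<in> edges G"
    using is_cycle_nth[OF cyc kn] ki by simp
  ultimately have "xs ! j = xs ! k"
    using par max[OF jn] max[OF kn] by metis
  then show False using dist jn kn jk by (simp add: nth_eq_iff_index_eq)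
qed

definition induced_subgraph :: "'v cell_graph \<Rightarrow> 'v set \<Rightarrow> 'v cell_graph" where
  "induced_subgraph G S = \<lparr>verts = S, edges = {e \<in> edges G. e \<subseteq> S}\<rparr>"

lemma induced_subgraph_simps [simp]:
  "verts (induced_subgraph G S) = S" "edges (induced_subgraph G S) = {e \<in> edges G. e \<subseteq> S}"
  by (simp_all add: induced_subgraph_def)

lemma is_tree_induced:
  assumes G: "is_tree G" "S \<subseteq> verts G" "S \<noteq> {}"
    and conn: "\<And>u v. u \<in> S \<Longrightarrow> v \<in> S \<Longrightarrow> (u, v) \<in> (adjacency (induced_subgraph G S))\<^sup>*"
  shows "is_tree (induced_subgraph G S)"
proof -
  have gr: "is_graph (induced_subgraph G S)"
    using G by (auto simp: is_tree_def is_graph_def)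
  have "is_cycle G xs" if "is_cycle (induced_subgraph G S) xs" for xs
    using that G(2) by (auto simp: is_cycle_def is_walk_def)
  then have "\<nexists>xs. is_cycle (induced_subgraph G S) xs"
    using G(1) unfolding is_tree_def by blast
  then show ?thesis
    unfolding is_tree_def using gr G(3) rtrancl_walk[OF conn gr] by auto
qed

section \<open>Trees with finite fins\<close>

text \<open>
  The fins are subtrees, included in the base tree and given by their finite vertex sets. The index of
  a fin is the code of its vertex set, so a map of the base tree that permutes the vertex sets acts on
  the indices without any choice.
\<close>

definition finned :: "nat cell_graph \<Rightarrow> nat set set \<Rightarrow> (nat, nat, nat) fin_data" where
  "finned T F = \<lparr>base_tree = T, fin_index = set_encode ` F,
     fin_tree = (\<lambda>i. induced_subgraph T (set_decode i)), fin_map = (\<lambda>i y. y)\<rparr>"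

lemma finned_simps [simp]:
  "base_tree (finned T F) = T" "fin_index (finned T F) = set_encode ` F"
  "fin_tree (finned T F) i = induced_subgraph T (set_decode i)" "fin_map (finned T F) i = (\<lambda>y. y)"
  by (simp_all add: finned_def)

text \<open>
  These are the automorphisms of the base tree that extend to the tree with fins: restriction
  (\<open>shadow\<close>) and extension (\<open>lift\<close>) below are mutually inverse.
\<close>

definition symmetries :: "nat cell_graph \<Rightarrow> nat set set \<Rightarrow> (nat \<Rightarrow> nat) set" where
  "symmetries T F = {g. bij g \<and> (\<forall>e. g ` e \<in> edges T \<longleftrightarrow> e \<in> edges T) \<and>
     (\<forall>S. g ` S \<in> F \<longleftrightarrow> S \<in> F)}"

fun foot :: "('v, 'i, 'v) fin_vertex \<Rightarrow> 'v" where
  "foot (Base v) = v"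
| "foot (Fin i y) = y"

locale finned_tree =
  fixes T :: "nat cell_graph" and F :: "nat set set"
  assumes tree: "is_tree T" and verts_T [simp]: "verts T = UNIV"
    and finite_fin: "S \<in> F \<Longrightarrow> finite S" and fin_nonempty: "S \<in> F \<Longrightarrow> S \<noteq> {}"
    and fin_connected:
      "S \<in> F \<Longrightarrow> u \<in> S \<Longrightarrow> v \<in> S \<Longrightarrow> (u, v) \<in> (adjacency (induced_subgraph T S))\<^sup>*"
    and point_finite: "finite {S \<in> F. v \<in> S}"
    and vertex_in_fin: "\<exists>S\<in>F. v \<in> S"
    and edge_in_fin: "e \<in> edges T \<Longrightarrow> \<exists>S\<in>F. e \<subseteq> S"
begin

abbreviation X where "X \<equiv> finned T F"
abbreviation V where "V \<equiv> verts (mapping_cylinder X)"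

lemma decode [simp]: "S \<in> F \<Longrightarrow> set_decode (set_encode S) = S"
  using finite_fin by (simp add: set_encode_inverse)

lemma encode_eq [simp]: "S \<in> F \<Longrightarrow> S' \<in> F \<Longrightarrow> set_encode S = set_encode S' \<longleftrightarrow> S = S'"
  using decode by metis

lemma graph: "is_graph T"
  using tree by (simp add: is_tree_def)

lemma tree_with_fins_X: "tree_with_fins X"
  unfolding tree_with_fins_def graph_embedding_def
  using tree fin_nonempty fin_connected by (auto intro!: is_tree_induced)

lemma fin_family:
  "{f i e | i e. i \<in> set_encode ` F \<and> P (set_decode i) e} = {f (set_encode S) e | S e. S \<in> F \<and> P S e}"
proof -
  have "(\<exists>i e. c = f i e \<and> i \<in> set_encode ` F \<and> P (set_decode i) e) \<longleftrightarrow>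
    (\<exists>S e. c = f (set_encode S) e \<and> S \<in> F \<and> P S e)" for c
    by (metis (no_types, lifting) decode image_iff)
  then show ?thesis by simp
qed

lemma V_eq: "V = range Base \<union> {Fin (set_encode S) y | S y. S \<in> F \<and> y \<in> S}"
  using fin_family[of "Fin :: nat \<Rightarrow> nat \<Rightarrow> (nat, nat, nat) fin_vertex" "\<lambda>S y. y \<in> S"] by (simp add: mapping_cylinder_def)

lemma Base_in_V [simp]: "Base v \<in> V"
  by (simp add: V_eq)

lemma Fin_in_V [simp]: "S \<in> F \<Longrightarrow> Fin (set_encode S) y \<in> V \<longleftrightarrow> y \<in> S"
  by (auto simp: V_eq)

lemma V_cases [consumes 1, case_names Base Fin]:
  assumes "z \<in> V"
  obtains v where "z = Base v" | S y where "z = Fin (set_encode S) y" "S \<in> F" "y \<in> S"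
  using assms by (auto simp: V_eq)

lemma edges_X: "edges (mapping_cylinder X) = (`) Base ` edges T \<union>
    {Fin (set_encode S) ` e | S e. S \<in> F \<and> e \<in> edges T \<and> e \<subseteq> S} \<union>
    {{Base y, Fin (set_encode S) y} | S y. S \<in> F \<and> y \<in> S}"
  using fin_family[of "\<lambda>i. (`) (Fin i :: nat \<Rightarrow> (nat, nat, nat) fin_vertex)" "\<lambda>S e. e \<in> edges T \<and> e \<subseteq> S"]
    fin_family[of "\<lambda>i y. {Base y, Fin i y}" "\<lambda>S y. y \<in> S"]
  by (simp add: mapping_cylinder_def)

lemma edge_cases [consumes 1, case_names base fin pillar]:
  assumes "c \<in> edges (mapping_cylinder X)"
  obtains e where "c = Base ` e" "e \<in> edges T"
    | S e where "c = Fin (set_encode S) ` e" "S \<in> F" "e \<in> edges T" "e \<subseteq> S"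
    | S y where "c = {Base y, Fin (set_encode S) y}" "S \<in> F" "y \<in> S"
  using assms[unfolded edges_X]
  by (elim UnE imageE CollectE exE conjE)
    (rule that(1), assumption+ | rule that(2), assumption+ | rule that(3), assumption+)+

lemma base_edge: "e \<in> edges T \<Longrightarrow> Base ` e \<in> edges (mapping_cylinder X)"
  unfolding edges_X by (intro UnI1 imageI)

lemma pillar_edge: "S \<in> F \<Longrightarrow> y \<in> S \<Longrightarrow> {Base y, Fin (set_encode S) y} \<in> edges (mapping_cylinder X)"
  unfolding edges_X by (intro UnI2 CollectI exI[of _ S] exI[of _ y]) simp

lemma fin_edge:
  "S \<in> F \<Longrightarrow> e \<in> edges T \<Longrightarrow> e \<subseteq> S \<Longrightarrow> Fin (set_encode S) ` e \<in> edges (mapping_cylinder X)"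
  unfolding edges_X by (intro UnI1 UnI2 CollectI exI[of _ S] exI[of _ e]) simp

lemma squares_X: "squares (mapping_cylinder X) =
    {Base ` e \<union> Fin (set_encode S) ` e | S e. S \<in> F \<and> e \<in> edges T \<and> e \<subseteq> S}"
  using fin_family[of "\<lambda>i e. Base ` e \<union> Fin i ` e" "\<lambda>S e. e \<in> edges T \<and> e \<subseteq> S"]
  by (simp add: mapping_cylinder_def)

text \<open>
  Every cell at a vertex lies over some fin through the foot of that vertex; these fins are finite in
  number, and each of them is finite.
\<close>

lemma locally_finite_X: "locally_finite (mapping_cylinder X)"
  unfolding locally_finite_def
proof
  fix z assume "z \<in> V"
  define block where "block S = Base ` S \<union> Fin (set_encode S) ` S" for S :: "nat set"
  have "\<exists>S\<in>F. foot z \<in> S \<and> c \<subseteq> block S"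
    if "c \<in> edges (mapping_cylinder X) \<union> squares (mapping_cylinder X)" "z \<in> c" for c
  proof -
    consider e where "c = Base ` e" "e \<in> edges T"
      | S where "c \<subseteq> block S" "S \<in> F"
      using \<open>c \<in> _\<close> unfolding edges_X squares_X block_def by blast
    then show ?thesis
    proof cases
      case 1
      then obtain S where "S \<in> F" "e \<subseteq> S" using edge_in_fin by blast
      then show ?thesis using 1 \<open>z \<in> c\<close> by (intro bexI[of _ S]) (auto simp: block_def)
    next
      case 2
      then show ?thesis using \<open>z \<in> c\<close> by (intro bexI[of _ S]) (auto simp: block_def)
    qed
  qed
  note in_block = this
  have "{c \<in> edges (mapping_cylinder X) \<union> squares (mapping_cylinder X). z \<in> c}
    \<subseteq> (\<Union>S\<in>{S \<in> F. foot z \<in> S}. Pow (block S))"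
  proof
    fix c assume "c \<in> {c \<in> edges (mapping_cylinder X) \<union> squares (mapping_cylinder X). z \<in> c}"
    then have "\<exists>S\<in>F. foot z \<in> S \<and> c \<subseteq> block S" using in_block by simp
    then show "c \<in> (\<Union>S\<in>{S \<in> F. foot z \<in> S}. Pow (block S))" by auto
  qed
  moreover have "finite (\<Union>S\<in>{S \<in> F. foot z \<in> S}. Pow (block S))"
    using point_finite finite_fin by (auto simp: block_def)
  ultimately show "finite {c \<in> edges (mapping_cylinder X) \<union> squares (mapping_cylinder X). z \<in> c}"
    by (rule finite_subset)
qed

lemma group_X: "group (Aut X)"
  using tree_with_fins_X by (rule group_Aut)

lemma carrier_Aut [simp]: "carrier (Aut X) = fin_auts X"
  by (simp add: Aut_def)

lemma fin_auts_Bij: "\<phi> \<in> fin_auts X \<Longrightarrow> \<phi> \<in> Bij V"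
  by (simp add: fin_auts_def cubical_automorphisms_def)

lemma fin_auts_bij_betw: "\<phi> \<in> fin_auts X \<Longrightarrow> bij_betw \<phi> V V"
  using fin_auts_Bij by (simp add: Bij_def)

lemma mult_Aut:
  "\<phi> \<in> fin_auts X \<Longrightarrow> \<psi> \<in> fin_auts X \<Longrightarrow> \<phi> \<otimes>\<^bsub>Aut X\<^esub> \<psi> = compose V \<phi> \<psi>"
  using fin_auts_Bij by (simp add: Aut_def BijGroup_def)

lemma one_Aut: "\<one>\<^bsub>Aut X\<^esub> = (\<lambda>z\<in>V. z)"
  by (simp add: Aut_def BijGroup_def)

definition shadow :: "((nat, nat, nat) fin_vertex \<Rightarrow> (nat, nat, nat) fin_vertex) \<Rightarrow> nat \<Rightarrow> nat"
  where "shadow \<phi> v = foot (\<phi> (Base v))"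

lemma aut_Base:
  assumes "\<phi> \<in> fin_auts X"
  shows "\<phi> (Base v) = Base (shadow \<phi> v)"
proof -
  have "\<phi> ` range Base = range Base"
    using assms by (simp add: fin_auts_def underlying_tree_def)
  then obtain w where "\<phi> (Base v) = Base w" by blast
  then show ?thesis by (simp add: shadow_def)
qed

lemma aut_inj: "\<phi> \<in> fin_auts X \<Longrightarrow> z \<in> V \<Longrightarrow> z' \<in> V \<Longrightarrow> \<phi> z = \<phi> z' \<longleftrightarrow> z = z'"
  using fin_auts_bij_betw by (metis bij_betw_def inj_on_eq_iff)

lemma aut_in_V: "\<phi> \<in> fin_auts X \<Longrightarrow> z \<in> V \<Longrightarrow> \<phi> z \<in> V"
  using fin_auts_bij_betw bij_betwE by blast

lemma aut_inv:
  assumes "\<phi> \<in> fin_auts X"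
  shows "inv\<^bsub>Aut X\<^esub> \<phi> \<in> fin_auts X"
    and "z \<in> V \<Longrightarrow> (inv\<^bsub>Aut X\<^esub> \<phi>) (\<phi> z) = z"
    and "z \<in> V \<Longrightarrow> \<phi> ((inv\<^bsub>Aut X\<^esub> \<phi>) z) = z"
proof -
  interpret group "Aut X" by (rule group_X)
  show *: "inv\<^bsub>Aut X\<^esub> \<phi> \<in> fin_auts X"
    using assms inv_closed by simp
  have "compose V (inv\<^bsub>Aut X\<^esub> \<phi>) \<phi> = (\<lambda>z\<in>V. z)" "compose V \<phi> (inv\<^bsub>Aut X\<^esub> \<phi>) = (\<lambda>z\<in>V. z)"
    using l_inv[of \<phi>] r_inv[of \<phi>] assms * by (simp_all add: mult_Aut one_Aut)
  from this[THEN fun_cong, of z]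
  show "z \<in> V \<Longrightarrow> (inv\<^bsub>Aut X\<^esub> \<phi>) (\<phi> z) = z" "z \<in> V \<Longrightarrow> \<phi> ((inv\<^bsub>Aut X\<^esub> \<phi>) z) = z"
    by (simp_all add: compose_eq)
qed

lemma aut_edge:
  assumes "\<phi> \<in> fin_auts X" "A \<in> edges (mapping_cylinder X)"
  shows "\<phi> ` A \<in> edges (mapping_cylinder X)"
proof -
  have "(`) \<phi> ` edges (mapping_cylinder X) = edges (mapping_cylinder X)"
    using assms(1) by (simp add: fin_auts_def cubical_automorphisms_def)
  then show ?thesis using assms(2) by (metis imageI)
qed

lemma edge_between_fins:
  assumes "{Fin i y, Fin j w} \<in> edges (mapping_cylinder X)" shows "i = j"
proof -
  define c :: "(nat, nat, nat) fin_vertex set" where "c = {Fin i y, Fin j w}"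
  have c: "Fin i y \<in> c" "Fin j w \<in> c" "\<And>v. Base v \<notin> c" by (auto simp: c_def)
  have "c \<in> edges (mapping_cylinder X)" using assms by (simp add: c_def)
  then show ?thesis
  proof (cases c rule: edge_cases)
    case (base e)
    then show ?thesis using c(1) by auto
  next
    case (fin S e)
    then show ?thesis using c(1,2) by auto
  next
    case (pillar S y)
    then show ?thesis using c(3) by auto
  qed
qed

text \<open>
  The pillar below a fin vertex is its only edge to the base tree, so the image of the foot
  determines the image of the fin vertex up to the choice of a fin.
\<close>

lemma aut_fin_vertex:
  assumes \<phi>: "\<phi> \<in> fin_auts X" and S: "S \<in> F" "y \<in> S"
  shows "\<exists>S'\<in>F. shadow \<phi> y \<in> S' \<and> \<phi> (Fin (set_encode S) y) = Fin (set_encode S') (shadow \<phi> y)"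
proof -
  let ?z = "Fin (set_encode S) y"
  have z: "?z \<in> V" using S by simp
  have "\<phi> ?z \<noteq> Base w" for w
  proof
    assume eq: "\<phi> ?z = Base w"
    have "Base w \<in> \<phi> ` range Base"
      using \<phi> by (simp add: fin_auts_def underlying_tree_def)
    then obtain v where "\<phi> (Base v) = \<phi> ?z" using eq by auto
    then show False using aut_inj[OF \<phi> _ z] by auto
  qed
  then obtain S' y' where S': "\<phi> ?z = Fin (set_encode S') y'" "S' \<in> F" "y' \<in> S'"
    using aut_in_V[OF \<phi> z] by (metis V_cases)
  have "{Base y, ?z} \<in> edges (mapping_cylinder X)"
    using S by (rule pillar_edge)
  then have "\<phi> ` {Base y, ?z} \<in> edges (mapping_cylinder X)"
    by (rule aut_edge[OF \<phi>])
  then have "{Base (shadow \<phi> y), Fin (set_encode S') y'} \<in> edges (mapping_cylinder X)"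
    by (simp add: aut_Base[OF \<phi>] S')
  then have "y' = shadow \<phi> y"
    unfolding edges_X by (auto simp: doubleton_eq_iff)
  then show ?thesis using S' by blast
qed

text \<open>
  No edge joins two different fins. Since a fin is connected, its image lies in a single fin.
\<close>

lemma aut_fin:
  assumes \<phi>: "\<phi> \<in> fin_auts X" and S: "S \<in> F"
  shows "\<exists>S'\<in>F. \<forall>y\<in>S. \<phi> (Fin (set_encode S) y) = Fin (set_encode S') (shadow \<phi> y)"
proof -
  obtain y0 where y0: "y0 \<in> S" using fin_nonempty[OF S] by blast
  obtain S' where S': "S' \<in> F" "\<phi> (Fin (set_encode S) y0) = Fin (set_encode S') (shadow \<phi> y0)"
    using aut_fin_vertex[OF \<phi> S y0] by blast
  have "\<phi> (Fin (set_encode S) y) = Fin (set_encode S') (shadow \<phi> y)" if "y \<in> S" for y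
    using fin_connected[OF S y0 that]
  proof (induction rule: rtrancl_induct)
    case base
    show ?case by (rule S')
  next
    case (step y w)
    then have e: "{y, w} \<in> edges T" "y \<in> S" "w \<in> S"
      by (auto simp: adjacency_def)
    obtain S'' where S'': "S'' \<in> F" "\<phi> (Fin (set_encode S) w) = Fin (set_encode S'') (shadow \<phi> w)"
      using aut_fin_vertex[OF \<phi> S e(3)] by blast
    have "Fin (set_encode S) ` {y, w} \<in> edges (mapping_cylinder X)"
      using S e by (intro fin_edge) auto
    then have "\<phi> ` Fin (set_encode S) ` {y, w} \<in> edges (mapping_cylinder X)"
      by (rule aut_edge[OF \<phi>])
    then have "{Fin (set_encode S') (shadow \<phi> y), Fin (set_encode S'') (shadow \<phi> w)}
        \<in> edges (mapping_cylinder X)"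
      by (simp add: S'' step.IH)
    then have "set_encode S' = set_encode S''"
      by (rule edge_between_fins)
    then show ?case using S'' by simp
  qed
  then show ?thesis using S' by blast
qed

lemma shadow_compose:
  assumes "\<phi> \<in> fin_auts X" "\<psi> \<in> fin_auts X"
  shows "shadow (\<phi> \<otimes>\<^bsub>Aut X\<^esub> \<psi>) = shadow \<phi> \<circ> shadow \<psi>"
  using assms by (auto simp: mult_Aut compose_eq aut_Base shadow_def[of "compose V \<phi> \<psi>"])

lemma shadow_one: "shadow \<one>\<^bsub>Aut X\<^esub> = id"
  by (auto simp: one_Aut shadow_def)

lemma shadow_inv:
  assumes "\<phi> \<in> fin_auts X"
  shows "shadow (inv\<^bsub>Aut X\<^esub> \<phi>) (shadow \<phi> v) = v" "shadow \<phi> (shadow (inv\<^bsub>Aut X\<^esub> \<phi>) v) = v"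
  using aut_inv(2,3)[OF assms, of "Base v"] aut_inv(1)[OF assms] assms
  by (simp_all add: aut_Base)

text \<open>
  The inverse automorphism maps the target fin back into a single fin, which has to be the original
  one; so the image of a fin is all of the target fin.
\<close>

lemma aut_Fin:
  assumes \<phi>: "\<phi> \<in> fin_auts X" and S: "S \<in> F"
  shows "shadow \<phi> ` S \<in> F"
    and "y \<in> S \<Longrightarrow> \<phi> (Fin (set_encode S) y) = Fin (set_encode (shadow \<phi> ` S)) (shadow \<phi> y)"
proof -
  let ?\<psi> = "inv\<^bsub>Aut X\<^esub> \<phi>"
  note \<psi> = aut_inv(1)[OF \<phi>]
  obtain S' where S': "S' \<in> F"
    and maps: "\<And>y. y \<in> S \<Longrightarrow> \<phi> (Fin (set_encode S) y) = Fin (set_encode S') (shadow \<phi> y)"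
    using aut_fin[OF \<phi> S] by blast
  obtain S'' where S'': "S'' \<in> F"
    and backwards: "\<And>w. w \<in> S' \<Longrightarrow> ?\<psi> (Fin (set_encode S') w) = Fin (set_encode S'') (shadow ?\<psi> w)"
    using aut_fin[OF \<psi> S'] by blast
  have sub: "shadow \<phi> y \<in> S'" if "y \<in> S" for y
    using aut_in_V[OF \<phi>, of "Fin (set_encode S) y"] maps[OF that] S S' that by simp
  have "S'' = S"
  proof -
    obtain y where y: "y \<in> S" using fin_nonempty[OF S] by blast
    have "?\<psi> (\<phi> (Fin (set_encode S) y)) = Fin (set_encode S) y"
      using aut_inv(2)[OF \<phi>] S y by simp
    then show ?thesis using backwards[OF sub[OF y]] maps[OF y] S S'' by simp
  qed
  have "w \<in> shadow \<phi> ` S" if "w \<in> S'" for w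
  proof -
    have "shadow ?\<psi> w \<in> S"
      using aut_in_V[OF \<psi>, of "Fin (set_encode S') w"] backwards[OF that] S S' that \<open>S'' = S\<close> by simp
    then show ?thesis by (metis imageI shadow_inv(2)[OF \<phi>])
  qed
  then have "shadow \<phi> ` S = S'" using sub by blast
  then show "shadow \<phi> ` S \<in> F"
    "y \<in> S \<Longrightarrow> \<phi> (Fin (set_encode S) y) = Fin (set_encode (shadow \<phi> ` S)) (shadow \<phi> y)"
    using S' maps by auto
qed

lemma shadow_bij: "\<phi> \<in> fin_auts X \<Longrightarrow> bij (shadow \<phi>)"
  using shadow_inv by (metis bijI')

lemma shadow_edge:
  assumes "\<phi> \<in> fin_auts X" "e \<in> edges T"
  shows "shadow \<phi> ` e \<in> edges T"
proof -
  have "(`) \<phi> ` (`) Base ` edges T = (`) Base ` edges T"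
    using assms(1) by (simp add: fin_auts_def underlying_tree_def)
  then have "\<phi> ` Base ` e \<in> (`) Base ` edges T"
    using assms(2) by (metis imageI)
  then have "Base ` shadow \<phi> ` e \<in> (`) (Base :: nat \<Rightarrow> (nat, nat, nat) fin_vertex) ` edges T"
    by (simp add: image_image aut_Base[OF assms(1)])
  then show ?thesis
    by (auto simp: inj_image_eq_iff inj_def)
qed

lemma shadow_symmetries:
  assumes \<phi>: "\<phi> \<in> fin_auts X" shows "shadow \<phi> \<in> symmetries T F"
proof -
  let ?\<psi> = "inv\<^bsub>Aut X\<^esub> \<phi>"
  note \<psi> = aut_inv(1)[OF \<phi>]
  have backwards: "shadow ?\<psi> ` shadow \<phi> ` A = A" for A
    by (simp add: image_image shadow_inv[OF \<phi>])
  have "shadow \<phi> ` e \<in> edges T \<longleftrightarrow> e \<in> edges T" for e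
    using shadow_edge[OF \<phi>] shadow_edge[OF \<psi>] backwards by metis
  moreover have "shadow \<phi> ` S \<in> F \<longleftrightarrow> S \<in> F" for S
    using aut_Fin(1)[OF \<phi>] aut_Fin(1)[OF \<psi>] backwards by metis
  ultimately show ?thesis
    using shadow_bij[OF \<phi>] by (simp add: symmetries_def)
qed

definition lift :: "(nat \<Rightarrow> nat) \<Rightarrow> (nat, nat, nat) fin_vertex \<Rightarrow> (nat, nat, nat) fin_vertex" where
  "lift g = (\<lambda>z\<in>V. case z of Base v \<Rightarrow> Base (g v)
      | Fin i y \<Rightarrow> Fin (set_encode (g ` set_decode i)) (g y))"

lemma lift_Base [simp]: "lift g (Base v) = Base (g v)"
  by (simp add: lift_def)

lemma lift_Fin [simp]:
  "S \<in> F \<Longrightarrow> y \<in> S \<Longrightarrow> lift g (Fin (set_encode S) y) = Fin (set_encode (g ` S)) (g y)"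
  by (simp add: lift_def)

lemma lift_undefined: "z \<notin> V \<Longrightarrow> lift g z = undefined"
  by (simp add: lift_def)

lemma symmetries_inv:
  assumes "g \<in> symmetries T F" shows "inv_into UNIV g \<in> symmetries T F"
proof -
  have b: "bij g" using assms by (simp add: symmetries_def)
  have gi: "g ` inv_into UNIV g ` A = A" for A
    using b by (simp add: image_f_inv_f bij_is_surj)
  have "inv_into UNIV g ` e \<in> edges T \<longleftrightarrow> e \<in> edges T" for e
    using assms gi[of e] unfolding symmetries_def by (metis (mono_tags, lifting) mem_Collect_eq)
  moreover have "inv_into UNIV g ` S \<in> F \<longleftrightarrow> S \<in> F" for S
    using assms gi[of S] unfolding symmetries_def by (metis (mono_tags, lifting) mem_Collect_eq)
  ultimately show ?thesis using b by (simp add: symmetries_def bij_imp_bij_inv)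
qed

lemma lift_compose:
  assumes "h \<in> symmetries T F"
  shows "z \<in> V \<Longrightarrow> lift g (lift h z) = lift (g \<circ> h) z"
  using assms by (elim V_cases) (auto simp: symmetries_def image_comp)

lemma lift_id: "z \<in> V \<Longrightarrow> lift id z = z"
  by (elim V_cases) auto

lemma symmetries_edge: "g \<in> symmetries T F \<Longrightarrow> g ` e \<in> edges T \<longleftrightarrow> e \<in> edges T"
  and symmetries_fin: "g \<in> symmetries T F \<Longrightarrow> g ` S \<in> F \<longleftrightarrow> S \<in> F"
  and symmetries_bij: "g \<in> symmetries T F \<Longrightarrow> bij g"
  by (simp_all add: symmetries_def)

lemma lift_image_Base: "lift g ` Base ` A = Base ` g ` A"
  by (simp add: image_image)

lemma lift_image_Fin:
  assumes "S \<in> F" "e \<subseteq> S"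
  shows "lift g ` Fin (set_encode S) ` e = Fin (set_encode (g ` S)) ` g ` e"
  using assms unfolding image_image by (intro image_cong) auto

lemma lift_edge:
  assumes g: "g \<in> symmetries T F" and A: "A \<in> edges (mapping_cylinder X)"
  shows "lift g ` A \<in> edges (mapping_cylinder X)"
  using A
proof (cases A rule: edge_cases)
  case (base e)
  then show ?thesis using g by (simp add: lift_image_Base symmetries_edge base_edge)
next
  case (fin S e)
  then have "Fin (set_encode (g ` S)) ` g ` e \<in> edges (mapping_cylinder X)"
    using g by (intro fin_edge) (auto simp: symmetries_edge symmetries_fin)
  then show ?thesis unfolding fin(1) lift_image_Fin[OF fin(2,4)] .
next
  case (pillar S y)
  then have "{Base (g y), Fin (set_encode (g ` S)) (g y)} \<in> edges (mapping_cylinder X)"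
    using g by (intro pillar_edge) (auto simp: symmetries_fin)
  then show ?thesis using pillar by simp
qed

lemma lift_square:
  assumes g: "g \<in> symmetries T F" and A: "A \<in> squares (mapping_cylinder X)"
  shows "lift g ` A \<in> squares (mapping_cylinder X)"
proof -
  obtain S e where *: "A = Base ` e \<union> Fin (set_encode S) ` e" "S \<in> F" "e \<in> edges T" "e \<subseteq> S"
    using A unfolding squares_X by blast
  have "lift g ` A = Base ` g ` e \<union> Fin (set_encode (g ` S)) ` g ` e"
    unfolding *(1) image_Un lift_image_Base lift_image_Fin[OF *(2,4)] ..
  moreover have "g ` S \<in> F" "g ` e \<in> edges T" "g ` e \<subseteq> g ` S"
    using * g by (auto simp: symmetries_edge symmetries_fin)
  ultimately show ?thesis unfolding squares_X by blast
qed

lemma lift_in_V: "g \<in> symmetries T F \<Longrightarrow> z \<in> V \<Longrightarrow> lift g z \<in> V"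
  by (elim V_cases) (auto simp: symmetries_fin)

lemma lift_fin_auts:
  assumes g: "g \<in> symmetries T F" shows "lift g \<in> fin_auts X"
proof -
  let ?h = "inv_into UNIV g"
  note h = symmetries_inv[OF g]
  have gh: "g \<circ> ?h = id" "?h \<circ> g = id"
    using symmetries_bij[OF g] by (simp_all add: surj_iff[symmetric] inj_iff[symmetric] bij_is_surj bij_is_inj)
  have inv1: "lift g (lift ?h z) = z" and inv2: "lift ?h (lift g z) = z" if "z \<in> V" for z
    using lift_compose[OF g that, of ?h] lift_compose[OF h that, of g] lift_id[OF that]
    unfolding gh by simp_all
  have bij: "bij_betw (lift g) V V"
    by (rule bij_betw_byWitness[of _ "lift ?h"])
      (use inv1 inv2 lift_in_V[OF g] lift_in_V[OF h] in auto)
  have onto: "(`) (lift g) ` \<A> = \<A>"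
    if sub: "\<A> \<subseteq> Pow V" and to: "\<And>A. A \<in> \<A> \<Longrightarrow> lift g ` A \<in> \<A>"
      and inv_to: "\<And>A. A \<in> \<A> \<Longrightarrow> lift ?h ` A \<in> \<A>" for \<A>
  proof
    show "(`) (lift g) ` \<A> \<subseteq> \<A>" using to by auto
    show "\<A> \<subseteq> (`) (lift g) ` \<A>"
    proof
      fix A assume A: "A \<in> \<A>"
      then have "\<And>z. z \<in> A \<Longrightarrow> lift g (lift ?h z) = z" using sub inv1 by auto
      then have "lift g ` lift ?h ` A = A" by (simp add: image_image)
      then show "A \<in> (`) (lift g) ` \<A>" using inv_to[OF A] by (metis imageI)
    qed
  qed
  have "(`) (lift g) ` edges (mapping_cylinder X) = edges (mapping_cylinder X)"
  proof (rule onto)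
    show "edges (mapping_cylinder X) \<subseteq> Pow V"
      unfolding edges_X by auto
  qed (use lift_edge g h in auto)
  moreover have "(`) (lift g) ` squares (mapping_cylinder X) = squares (mapping_cylinder X)"
  proof (rule onto)
    show "squares (mapping_cylinder X) \<subseteq> Pow V"
      unfolding squares_X by auto
  qed (use lift_square g h in auto)
  moreover have "(`) (lift g) ` ((`) Base ` edges T) = (`) Base ` edges T"
    by (rule onto) (auto simp: lift_image_Base symmetries_edge g h)
  moreover have "lift g ` range Base = range Base"
    using symmetries_bij[OF g] by (simp add: lift_image_Base bij_is_surj)
  moreover have "lift g \<in> Bij V"
    using bij by (simp add: Bij_def lift_def)
  ultimately show ?thesis
    by (simp add: fin_auts_def cubical_automorphisms_def underlying_tree_def)
qed

lemma shadow_lift [simp]: "shadow (lift g) = g"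
  by (auto simp: shadow_def)

lemma lift_shadow:
  assumes "\<phi> \<in> fin_auts X" shows "lift (shadow \<phi>) = \<phi>"
proof
  fix z
  show "lift (shadow \<phi>) z = \<phi> z"
  proof (cases "z \<in> V")
    case True
    then show ?thesis
      using assms by (cases z rule: V_cases) (simp_all add: aut_Base aut_Fin(2))
  next
    case False
    then show ?thesis
      using fin_auts_Bij[OF assms] by (simp add: lift_undefined Bij_def extensional_def)
  qed
qed

end

section \<open>Free uniform lattices from groups of tree automorphisms\<close>

text \<open>
  The point on the edge from \<open>w\<close> to \<open>u\<close> with barycentric coordinate \<open>s\<close> at \<open>u\<close>. For
  \<open>u = w\<close> this is the vertex, whatever \<open>s\<close> is, so vertices and edges need no separate treatment.
\<close>

definition segment :: "'v \<Rightarrow> 'v \<Rightarrow> real \<Rightarrow> 'v \<Rightarrow> real" where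
  "segment u w s v = (if v = u then s else 0) + (if v = w then 1 - s else 0)"

lemma segment_in_graph_points:
  assumes "u \<in> verts G" "w \<in> verts G" "u = w \<or> {u, w} \<in> edges G" "0 \<le> s" "s \<le> 1"
  shows "segment u w s \<in> graph_points G"
proof -
  have "{u, w} \<in> (\<lambda>v. {v}) ` verts G \<union> edges G"
    using assms by auto
  moreover have "\<forall>v. 0 \<le> segment u w s v" "\<forall>v. v \<notin> {u, w} \<longrightarrow> segment u w s v = 0"
    using assms by (auto simp: segment_def)
  moreover have "(\<Sum>v\<in>{u, w}. segment u w s v) = 1"
    by (cases "u = w") (auto simp: segment_def)
  ultimately show ?thesis unfolding graph_points_def by blast
qed

lemma graph_points_segment:
  assumes G: "is_graph G" and q: "q \<in> graph_points G"
  obtains u w s where "u \<in> verts G" "w \<in> verts G" "u = w \<or> {u, w} \<in> edges G" "0 \<le> s" "s \<le> 1"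
    "q = segment u w s"
proof -
  obtain c where c: "c \<in> (\<lambda>v. {v}) ` verts G \<union> edges G" and pos: "\<And>v. 0 \<le> q v"
    and zero: "\<And>v. v \<notin> c \<Longrightarrow> q v = 0" and sum: "(\<Sum>v\<in>c. q v) = 1"
    using q unfolding graph_points_def by blast
  consider v where "v \<in> verts G" "c = {v}" | "c \<in> edges G" using c by blast
  then show thesis
  proof cases
    case 1
    have "q = segment v v 1"
      using zero sum 1 by (auto simp: segment_def fun_eq_iff)
    then show thesis using 1 by (intro that[of v v 1]) auto
  next
    case 2
    then have "card c = 2" using G by (simp add: is_graph_def)
    then obtain u w where uw: "c = {u, w}" "u \<noteq> w" by (meson card_2_iff)
    have w: "q w = 1 - q u" using sum uw by simp
    have "q = segment u w (q u)"
      using zero uw w by (auto simp: segment_def fun_eq_iff)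
    moreover have "u \<in> verts G" "w \<in> verts G" using edge_verts[OF G] 2 uw by blast+
    ultimately show thesis
      using 2 uw pos[of u] pos[of w] w by (intro that[of u w "q u"]) auto
  qed
qed

context finned_tree
begin

text \<open>
  A cell is a vertex (\<open>u = w\<close>) or an edge of a fin, and stands for the vertical segment or the square
  below it. As every vertex and every edge of the base tree lies in a fin, these cover the base tree
  as well.
\<close>

definition cells :: "(nat set \<times> nat \<times> nat) set" where
  "cells = {(S, u, w). S \<in> F \<and> u \<in> S \<and> w \<in> S \<and> (u = w \<or> {u, w} \<in> edges T)}"

definition cell_point :: "nat set \<Rightarrow> nat \<Rightarrow> nat \<Rightarrow> real \<Rightarrow> real \<Rightarrow> (nat, nat, nat) fin_vertex \<Rightarrow> real"
  where "cell_point S u w s t z = (case z of Base v \<Rightarrow> (1 - t) * segment u w s v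
    | Fin i y \<Rightarrow> if i = set_encode S then t * segment u w s y else 0)"

lemma cell_point_eq_cylinder_point:
  assumes "(S, u, w) \<in> cells"
  shows "cylinder_point X (set_encode S) (segment u w s) t = cell_point S u w s t"
proof
  fix z
  have S: "S \<in> F" "u \<in> S" "w \<in> S" using assms by (auto simp: cells_def)
  have "(\<Sum>y | y \<in> S \<and> y = v. segment u w s y) = segment u w s v" for v
  proof (cases "v \<in> S")
    case True
    then have "{y. y \<in> S \<and> y = v} = {v}" by auto
    then show ?thesis by simp
  next
    case False
    then have "{y. y \<in> S \<and> y = v} = {}" "segment u w s v = 0"
      using S by (auto simp: segment_def)
    then show ?thesis by simp
  qed
  then show "cylinder_point X (set_encode S) (segment u w s) t z = cell_point S u w s t z"
    using S by (cases z) (simp_all add: cylinder_point_def cell_point_def)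
qed

lemma base_point_eq_cell_point: "base_point (segment u w s) = cell_point S u w s 0"
  by (auto simp: base_point_def cell_point_def fun_eq_iff split: fin_vertex.splits)

lemma edge_cell:
  assumes "u = w \<or> {u, w} \<in> edges T" obtains S where "(S, u, w) \<in> cells"
proof (cases "u = w")
  case True
  obtain S where "S \<in> F" "u \<in> S" using vertex_in_fin by blast
  then show thesis using True by (intro that[of S]) (simp add: cells_def)
next
  case False
  then obtain S where "S \<in> F" "{u, w} \<subseteq> S" using assms edge_in_fin by blast
  then show thesis using False assms by (intro that[of S]) (simp add: cells_def)
qed

text \<open>
  Points of the base tree occur as points of height 0 in the square or segment below a fin.
\<close>

lemma points_X:
  "p \<in> points X \<longleftrightarrow> (\<exists>S u w s t. (S, u, w) \<in> cells \<and> 0 \<le> s \<and> s \<le> 1 \<and> 0 \<le> t \<and> t \<le> 1 \<and>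
     p = cell_point S u w s t)" (is "_ \<longleftrightarrow> ?R")
proof
  assume "p \<in> points X"
  then consider q where "q \<in> graph_points T" "p = base_point q"
    | S q t where "S \<in> F" "q \<in> graph_points (induced_subgraph T S)" "0 \<le> t" "t \<le> 1"
        "p = cylinder_point X (set_encode S) q t"
    unfolding points_def by auto
  then show ?R
  proof cases
    case 1
    obtain u w s where uw: "u = w \<or> {u, w} \<in> edges T" "0 \<le> s" "s \<le> 1" "q = segment u w s"
      using graph_points_segment[OF graph 1(1)] by metis
    obtain S where "(S, u, w) \<in> cells" using edge_cell[OF uw(1)] by blast
    then show ?thesis
      using uw(2-) 1(2) base_point_eq_cell_point[of u w s S]
      by (intro exI[of _ S] exI[of _ u] exI[of _ w] exI[of _ s] exI[of _ 0]) simp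
  next
    case 2
    have "is_graph (induced_subgraph T S)" using graph by (simp add: is_graph_def)
    then obtain u w s where uw: "u \<in> S" "w \<in> S" "u = w \<or> {u, w} \<in> edges T"
      "0 \<le> s" "s \<le> 1" "q = segment u w s"
      using graph_points_segment[OF _ 2(2)] by (metis (no_types, lifting) induced_subgraph_simps mem_Collect_eq)
    have cell: "(S, u, w) \<in> cells" using 2 uw by (simp add: cells_def)
    then show ?thesis
      using 2 uw(4-) cell_point_eq_cylinder_point[OF cell, of s t]
      by (intro exI[of _ S] exI[of _ u] exI[of _ w] exI[of _ s] exI[of _ t]) simp
  qed
next
  assume ?R
  then obtain S u w s t where *: "(S, u, w) \<in> cells" "0 \<le> s" "s \<le> 1" "0 \<le> t" "t \<le> 1"
    "p = cell_point S u w s t" by blast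
  have "segment u w s \<in> graph_points (induced_subgraph T S)"
    using * by (intro segment_in_graph_points) (auto simp: cells_def)
  moreover have "S \<in> F" "p = cylinder_point X (set_encode S) (segment u w s) t"
    using * cell_point_eq_cylinder_point by (auto simp: cells_def)
  ultimately show "p \<in> points X"
    unfolding points_def using *
    by (intro UnI2 CollectI exI[of _ "set_encode S"] exI[of _ "segment u w s"] exI[of _ t]) auto
qed

lemma cell_point_support:
  assumes "(S, u, w) \<in> cells" "cell_point S u w s t z \<noteq> 0"
  shows "z \<in> V" "foot z \<in> {u, w}"
proof -
  have S: "S \<in> F" "u \<in> S" "w \<in> S" using assms(1) by (auto simp: cells_def)
  show "foot z \<in> {u, w}" "z \<in> V"
    using assms(2) S
    by (cases z; auto simp: cell_point_def segment_def split: if_splits)+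
qed

lemma cell_point_positive:
  assumes "(S, u, w) \<in> cells" "0 \<le> s" "s \<le> 1" "0 \<le> t" "t \<le> 1"
  obtains z where "0 < cell_point S u w s t z"
proof -
  obtain v where v: "0 < segment u w s v"
  proof (cases "0 < s")
    case True
    then have "0 < segment u w s u" using assms by (auto simp: segment_def)
    then show ?thesis by (rule that)
  next
    case False
    then have "0 < segment u w s w" using assms by (auto simp: segment_def)
    then show ?thesis by (rule that)
  qed
  show thesis
  proof (cases "0 < t")
    case True
    then have "0 < cell_point S u w s t (Fin (set_encode S) v)" using v by (simp add: cell_point_def)
    then show thesis by (rule that)
  next
    case False
    then have "0 < cell_point S u w s t (Base v)" using v by (simp add: cell_point_def)
    then show thesis by (rule that)
  qed
qed

lemma foot_aut: "\<phi> \<in> fin_auts X \<Longrightarrow> z \<in> V \<Longrightarrow> foot (\<phi> z) = shadow \<phi> (foot z)"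
  by (elim V_cases) (simp_all add: aut_Base aut_Fin(2))

lemma act_apply: "\<phi> \<in> fin_auts X \<Longrightarrow> z \<in> V \<Longrightarrow> act X \<phi> p (\<phi> z) = p z"
  using fin_auts_bij_betw by (simp add: act_def aut_in_V bij_betw_def)

lemma cells_aut:
  assumes "\<phi> \<in> fin_auts X" "(S, u, w) \<in> cells"
  shows "(shadow \<phi> ` S, shadow \<phi> u, shadow \<phi> w) \<in> cells"
  using assms aut_Fin(1)[OF assms(1)] shadow_edge[OF assms(1), of "{u, w}"] by (auto simp: cells_def)

lemma act_cell_point:
  assumes \<phi>: "\<phi> \<in> fin_auts X" and cell: "(S, u, w) \<in> cells"
  shows "act X \<phi> (cell_point S u w s t) = cell_point (shadow \<phi> ` S) (shadow \<phi> u) (shadow \<phi> w) s t"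
proof
  fix z
  let ?g = "shadow \<phi>"
  have inj: "?g a = ?g b \<longleftrightarrow> a = b" for a b
    using shadow_bij[OF \<phi>] by (simp add: bij_is_inj inj_eq)
  have S: "S \<in> F" using cell by (simp add: cells_def)
  show "act X \<phi> (cell_point S u w s t) z = cell_point (?g ` S) (?g u) (?g w) s t z"
  proof (cases "z \<in> V")
    case True
    then obtain z' where z': "z' \<in> V" "z = \<phi> z'"
      using fin_auts_bij_betw[OF \<phi>] by (auto simp: bij_betw_def)
    have "cell_point S u w s t z' = cell_point (?g ` S) (?g u) (?g w) s t (\<phi> z')"
      using z'(1)
    proof (cases z' rule: V_cases)
      case (Base v)
      then show ?thesis by (simp add: cell_point_def segment_def aut_Base[OF \<phi>] inj)
    next
      case (Fin S' y)
      have "?g ` S' = ?g ` S \<longleftrightarrow> S' = S"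
        using shadow_bij[OF \<phi>] by (simp add: bij_is_inj inj_image_eq_iff)
      then show ?thesis
        using Fin S by (simp add: cell_point_def segment_def aut_Fin[OF \<phi>] inj)
    qed
    then show ?thesis using act_apply[OF \<phi> z'(1)] z'(2) by simp
  next
    case False
    then have "cell_point (?g ` S) (?g u) (?g w) s t z = 0"
      using cell_point_support(1)[OF cells_aut[OF \<phi> cell]] by blast
    then show ?thesis using False by (simp add: act_def)
  qed
qed

lemma finite_neighbours: "finite {w. v = w \<or> {v, w} \<in> edges T}"
proof -
  have "{w. v = w \<or> {v, w} \<in> edges T} \<subseteq> insert v (\<Union>{S \<in> F. v \<in> S})"
  proof
    fix w assume "w \<in> {w. v = w \<or> {v, w} \<in> edges T}"
    then show "w \<in> insert v (\<Union>{S \<in> F. v \<in> S})"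
      using edge_in_fin[of "{v, w}"] by auto
  qed
  moreover have "finite (insert v (\<Union>{S \<in> F. v \<in> S}))"
    using point_finite finite_fin by auto
  ultimately show ?thesis by (rule finite_subset)
qed

text \<open>
  The sets where the weight of a given vertex is positive are open and cover the complex, so finitely
  many vertices suffice for a compact set. An element that moves the compact set to meet itself maps
  one of these vertices into the closed neighbourhood of another one.
\<close>

lemma acts_properlyI:
  assumes \<Gamma>: "\<Gamma> \<subseteq> fin_auts X" and fin: "\<And>v w. finite {\<phi> \<in> \<Gamma>. shadow \<phi> v = w}"
  shows "acts_properly X \<Gamma>"
  unfolding acts_properly_def
proof (intro allI impI)
  fix K assume K: "K \<subseteq> points X \<and> compact K"
  have "open {p :: (nat, nat, nat) fin_vertex \<Rightarrow> real. 0 < p z}" for z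
    by (intro open_Collect_less continuous_on_const continuous_on_product_coordinates)
  moreover have "K \<subseteq> (\<Union>z\<in>UNIV. {p. 0 < p z})"
  proof
    fix p assume "p \<in> K"
    then have "p \<in> points X" using K by blast
    then obtain S u w s t
      where cell: "(S, u, w) \<in> cells" "0 \<le> s" "s \<le> 1" "0 \<le> t" "t \<le> 1"
        and peq: "p = cell_point S u w s t"
      unfolding points_X by blast
    obtain z where "0 < cell_point S u w s t z" using cell_point_positive[OF cell] .
    then show "p \<in> (\<Union>z\<in>UNIV. {p. 0 < p z})" by (auto simp: peq)
  qed
  ultimately obtain Z where Z: "finite Z" "K \<subseteq> (\<Union>z\<in>Z. {p. 0 < p z})"
    by (rule compactE_image[OF conjunct2[OF K]])
  let ?N = "\<lambda>v. {w. v = w \<or> {v, w} \<in> edges T}"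
  have "{\<phi> \<in> \<Gamma>. act X \<phi> ` K \<inter> K \<noteq> {}}
    \<subseteq> (\<Union>z\<in>Z. \<Union>z'\<in>Z. \<Union>w\<in>?N (foot z'). {\<phi> \<in> \<Gamma>. shadow \<phi> (foot z) = w})"
  proof
    fix \<phi> assume "\<phi> \<in> {\<phi> \<in> \<Gamma>. act X \<phi> ` K \<inter> K \<noteq> {}}"
    then obtain p where \<phi>: "\<phi> \<in> \<Gamma>" and p: "p \<in> K" "act X \<phi> p \<in> K" by blast
    have \<phi>': "\<phi> \<in> fin_auts X" using \<phi> \<Gamma> by blast
    obtain S u w s t where cell: "(S, u, w) \<in> cells" and peq: "p = cell_point S u w s t"
    proof -
      have "p \<in> points X" using p K by blast
      then show thesis using that unfolding points_X by blast
    qed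
    obtain z z' where z: "z \<in> Z" "0 < p z" and z': "z' \<in> Z" "0 < act X \<phi> p z'"
      using p Z(2) by blast
    have "cell_point S u w s t z \<noteq> 0" using z(2) peq by simp
    note cell_point_support[OF cell this]
    then have "shadow \<phi> (foot z) \<in> {shadow \<phi> u, shadow \<phi> w}" by auto
    moreover have "cell_point (shadow \<phi> ` S) (shadow \<phi> u) (shadow \<phi> w) s t z' \<noteq> 0"
      using z'(2) unfolding peq act_cell_point[OF \<phi>' cell] by simp
    then have "foot z' \<in> {shadow \<phi> u, shadow \<phi> w}"
      by (rule cell_point_support(2)[OF cells_aut[OF \<phi>' cell]])
    moreover have "shadow \<phi> u = shadow \<phi> w \<or> {shadow \<phi> u, shadow \<phi> w} \<in> edges T"
      using cells_aut[OF \<phi>' cell] by (simp add: cells_def)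
    ultimately have "shadow \<phi> (foot z) \<in> ?N (foot z')" by (auto simp: insert_commute)
    then show "\<phi> \<in> (\<Union>z\<in>Z. \<Union>z'\<in>Z. \<Union>w\<in>?N (foot z'). {\<phi> \<in> \<Gamma>. shadow \<phi> (foot z) = w})"
      using z z' \<phi> by blast
  qed
  moreover have "finite (\<Union>z\<in>Z. \<Union>z'\<in>Z. \<Union>w\<in>?N (foot z'). {\<phi> \<in> \<Gamma>. shadow \<phi> (foot z) = w})"
    using Z(1) fin finite_neighbours by auto
  ultimately show "finite {\<phi> \<in> \<Gamma>. act X \<phi> ` K \<inter> K \<noteq> {}}" by (rule finite_subset)
qed

text \<open>
  A single vertex is a compact set, to which properness applies.
\<close>

lemma finite_stabiliser:
  assumes \<Lambda>: "uniform_lattice X \<Lambda>"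
  shows "finite {\<phi> \<in> \<Lambda>. shadow \<phi> v = v}"
proof -
  have sub: "\<Lambda> \<subseteq> fin_auts X" and proper: "acts_properly X \<Lambda>"
    using \<Lambda> subgroup.subset[of \<Lambda> "Aut X"] by (auto simp: uniform_lattice_def)
  obtain S where S: "(S, v, v) \<in> cells" using edge_cell[of v v] by blast
  define p where "p = cell_point S v v 1 0"
  have "p \<in> points X" unfolding points_X p_def using S by (intro exI conjI) auto
  have fixed: "act X \<phi> p = p" if "\<phi> \<in> \<Lambda>" "shadow \<phi> v = v" for \<phi>
    using act_cell_point[of \<phi> S v v 1 0] that sub S
      base_point_eq_cell_point[of v v 1 S] base_point_eq_cell_point[of v v 1 "shadow \<phi> ` S"]
    by (auto simp: p_def)
  have "finite {\<phi> \<in> \<Lambda>. act X \<phi> ` {p} \<inter> {p} \<noteq> {}}"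
    using proper[unfolded acts_properly_def, rule_format, of "{p}"] \<open>p \<in> points X\<close> by simp
  then show ?thesis
    by (rule rev_finite_subset) (use fixed in auto)
qed

definition piece :: "nat set \<times> nat \<times> nat \<Rightarrow> ((nat, nat, nat) fin_vertex \<Rightarrow> real) set" where
  "piece = (\<lambda>(S, u, w). (\<lambda>(s, t). cell_point S u w s t) ` ({0..1} \<times> {0..1}))"

lemma compact_piece: "compact (piece c)"
proof -
  obtain S u w where c: "c = (S, u, w)" by (cases c)
  have seg: "continuous_on A (\<lambda>x. segment u w (fst x) v)" for v and A :: "(real \<times> real) set"
    by (cases "v = u"; cases "v = w") (auto simp: segment_def intro!: continuous_intros)
  have "continuous_on A (\<lambda>x. (case x of (s, t) \<Rightarrow> cell_point S u w s t) z)"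
    for z and A :: "(real \<times> real) set"
  proof (cases z)
    case (Base v)
    then show ?thesis using seg by (auto simp: cell_point_def case_prod_beta intro!: continuous_intros)
  next
    case (Fin i y)
    then show ?thesis
      using seg by (cases "i = set_encode S") (auto simp: cell_point_def case_prod_beta intro!: continuous_intros)
  qed
  then have "continuous_on A (\<lambda>(s, t). cell_point S u w s t)" for A :: "(real \<times> real) set"
    by (rule continuous_on_coordinatewise_then_product)
  then show ?thesis
    unfolding piece_def c by (simp add: compact_continuous_image compact_Times)
qed

lemma points_pieces: "points X = (\<Union>c\<in>cells. piece c)"
proof (rule Set.set_eqI)
  fix p
  have piece: "p \<in> piece (S, u, w) \<longleftrightarrow>
    (\<exists>s t. 0 \<le> s \<and> s \<le> 1 \<and> 0 \<le> t \<and> t \<le> 1 \<and> p = cell_point S u w s t)" for S u w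
    by (auto simp: piece_def) blast
  have "p \<in> (\<Union>c\<in>cells. piece c) \<longleftrightarrow> (\<exists>S u w. (S, u, w) \<in> cells \<and> p \<in> piece (S, u, w))"
    by auto
  then show "p \<in> points X \<longleftrightarrow> p \<in> (\<Union>c\<in>cells. piece c)"
    unfolding piece points_X by blast
qed

lemma act_piece:
  assumes "\<phi> \<in> fin_auts X" "(S, u, w) \<in> cells"
  shows "act X \<phi> ` piece (S, u, w) = piece (shadow \<phi> ` S, shadow \<phi> u, shadow \<phi> w)"
  unfolding piece_def using act_cell_point[OF assms]
  by (simp add: image_image case_prod_beta)

text \<open>
  The compact set is the union of the closed cells with a corner over \<open>R\<close>, which are finite in number
  by local finiteness.
\<close>

lemma acts_cocompactlyI:
  assumes \<Gamma>: "\<Gamma> \<subseteq> fin_auts X" "finite R" and orb: "\<And>v. \<exists>r\<in>R. \<exists>\<phi>\<in>\<Gamma>. shadow \<phi> r = v"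
  shows "acts_cocompactly X \<Gamma>"
proof -
  define C where "C = {(S, u, w) \<in> cells. u \<in> R}"
  have "C \<subseteq> (\<Union>r\<in>R. \<Union>S\<in>{S \<in> F. r \<in> S}. {S} \<times> {r} \<times> S)"
    by (auto simp: C_def cells_def)
  then have "finite C"
    by (rule finite_subset) (use \<Gamma>(2) point_finite finite_fin in auto)
  define K where "K = (\<Union>c\<in>C. piece c)"
  have "compact K" unfolding K_def using \<open>finite C\<close> compact_piece by (intro compact_UN) auto
  moreover have "K \<subseteq> points X" unfolding K_def points_pieces by (auto simp: C_def)
  moreover have "(\<Union>\<phi>\<in>\<Gamma>. act X \<phi> ` K) = points X"
  proof (intro equalityI subsetI)
    fix p assume "p \<in> (\<Union>\<phi>\<in>\<Gamma>. act X \<phi> ` K)"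
    then obtain \<phi> S u w where *: "\<phi> \<in> \<Gamma>" "(S, u, w) \<in> cells" "p \<in> act X \<phi> ` piece (S, u, w)"
      by (auto simp: K_def C_def)
    then show "p \<in> points X"
      using \<Gamma>(1) cells_aut[of \<phi> S u w] act_piece[of \<phi> S u w] unfolding points_pieces by blast
  next
    fix p assume "p \<in> points X"
    then obtain S u w where cell: "(S, u, w) \<in> cells" and p: "p \<in> piece (S, u, w)"
      unfolding points_pieces by auto
    obtain r \<phi> where r: "r \<in> R" "\<phi> \<in> \<Gamma>" "shadow \<phi> r = u" using orb by blast
    then have \<phi>: "\<phi> \<in> fin_auts X" using \<Gamma>(1) by blast
    let ?h = "shadow (inv\<^bsub>Aut X\<^esub> \<phi>)"
    have cell': "(?h ` S, ?h u, ?h w) \<in> cells"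
      using cells_aut[OF aut_inv(1)[OF \<phi>] cell] .
    have "?h u = r" using r(3) shadow_inv(1)[OF \<phi>] by blast
    then have "(?h ` S, ?h u, ?h w) \<in> C" using cell' r(1) by (simp add: C_def)
    moreover have "act X \<phi> ` piece (?h ` S, ?h u, ?h w) = piece (S, u, w)"
      using act_piece[OF \<phi> cell'] by (simp add: image_image shadow_inv(2)[OF \<phi>])
    ultimately show "p \<in> (\<Union>\<phi>\<in>\<Gamma>. act X \<phi> ` K)"
      using p r(2) unfolding K_def by blast
  qed
  ultimately show ?thesis unfolding acts_cocompactly_def by blast
qed

text \<open>
  The feet of the vertices on which a fixed point has positive weight form an invariant vertex or
  edge of the base tree.
\<close>

lemma acts_freelyI:
  assumes \<Gamma>: "\<Gamma> \<subseteq> fin_auts X"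
    and free: "\<And>\<phi> v. \<phi> \<in> \<Gamma> \<Longrightarrow> shadow \<phi> v = v \<Longrightarrow> \<phi> = \<one>\<^bsub>Aut X\<^esub>"
    and no_inversion: "\<And>\<phi> v. \<phi> \<in> \<Gamma> \<Longrightarrow> {v, shadow \<phi> v} \<in> edges T \<Longrightarrow> shadow \<phi> (shadow \<phi> v) \<noteq> v"
  shows "acts_freely X \<Gamma>"
  unfolding acts_freely_def
proof (intro ballI impI)
  fix \<phi> assume \<phi>: "\<phi> \<in> \<Gamma>" and "\<exists>p\<in>points X. act X \<phi> p = p"
  then obtain S u w s t where cell: "(S, u, w) \<in> cells" "0 \<le> s" "s \<le> 1" "0 \<le> t" "t \<le> 1"
    and fixed: "act X \<phi> (cell_point S u w s t) = cell_point S u w s t"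
    using points_X by metis
  have \<phi>': "\<phi> \<in> fin_auts X" using \<phi> \<Gamma> by blast
  define A where "A = foot ` {z. cell_point S u w s t z \<noteq> 0}"
  have A: "A \<subseteq> {u, w}" using cell_point_support(2)[OF cell(1)] by (auto simp: A_def)
  obtain z where "0 < cell_point S u w s t z" using cell_point_positive[OF cell] .
  then have "cell_point S u w s t z \<noteq> 0" by simp
  then have "foot z \<in> A" by (auto simp: A_def)
  have inv: "shadow \<phi> v \<in> A" if v: "v \<in> A" for v
  proof -
    obtain z where z: "v = foot z" "cell_point S u w s t z \<noteq> 0" using v by (auto simp: A_def)
    then have "z \<in> V" using cell_point_support(1)[OF cell(1)] by blast
    then have "cell_point S u w s t (\<phi> z) \<noteq> 0" "shadow \<phi> v = foot (\<phi> z)"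
      using act_apply[OF \<phi>', of z "cell_point S u w s t"] z fixed foot_aut[OF \<phi>'] by auto
    then show ?thesis by (auto simp: A_def)
  qed
  let ?v = "foot z"
  have mem: "?v \<in> {u, w}" "shadow \<phi> ?v \<in> {u, w}" "shadow \<phi> (shadow \<phi> ?v) \<in> {u, w}"
    using A inv \<open>foot z \<in> A\<close> by blast+
  show "\<phi> = \<one>\<^bsub>Aut X\<^esub>"
  proof (cases "shadow \<phi> ?v = ?v")
    case True
    then show ?thesis using free \<phi> by blast
  next
    case False
    then have uw: "{u, w} = {?v, shadow \<phi> ?v}" using mem by auto
    then have "{?v, shadow \<phi> ?v} \<in> edges T" using cell(1) False by (auto simp: cells_def)
    moreover have "shadow \<phi> (shadow \<phi> ?v) \<noteq> shadow \<phi> ?v"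
      using False shadow_bij[OF \<phi>'] by (simp add: bij_is_inj inj_eq)
    ultimately have False using no_inversion[OF \<phi>] mem(3) unfolding uw by auto
    then show ?thesis ..
  qed
qed

lemma lift_one: "lift id = \<one>\<^bsub>Aut X\<^esub>"
  using lift_shadow[of "\<one>\<^bsub>Aut X\<^esub>"] group_X shadow_one
  by (metis carrier_Aut group.is_monoid monoid.one_closed)

lemma lift_mult:
  assumes "g \<in> symmetries T F" "h \<in> symmetries T F"
  shows "lift g \<otimes>\<^bsub>Aut X\<^esub> lift h = lift (g \<circ> h)"
proof -
  have "lift g \<otimes>\<^bsub>Aut X\<^esub> lift h \<in> fin_auts X"
    using group_X lift_fin_auts assms by (metis carrier_Aut group.is_monoid monoid.m_closed)
  from lift_shadow[OF this] show ?thesis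
    using shadow_compose[of "lift g" "lift h"] lift_fin_auts assms by simp
qed

theorem free_uniform_lattice_lift:
  assumes H: "H \<subseteq> symmetries T F" "id \<in> H" "\<And>g h. g \<in> H \<Longrightarrow> h \<in> H \<Longrightarrow> g \<circ> h \<in> H"
      "\<And>g. g \<in> H \<Longrightarrow> inv_into UNIV g \<in> H"
    and free: "\<And>g v. g \<in> H \<Longrightarrow> g v = v \<Longrightarrow> g = id"
    and no_inversion: "\<And>g v. g \<in> H \<Longrightarrow> {v, g v} \<in> edges T \<Longrightarrow> g (g v) \<noteq> v"
    and cofinite: "finite R" "\<And>v. \<exists>r\<in>R. \<exists>g\<in>H. g r = v"
  shows "free_uniform_lattice X (lift ` H)"
proof -
  interpret group "Aut X" by (rule group_X)
  have sub: "lift ` H \<subseteq> fin_auts X" using H(1) lift_fin_auts by blast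
  have inv: "inv\<^bsub>Aut X\<^esub> (lift g) = lift (inv_into UNIV g)" if "g \<in> H" for g
  proof (rule inv_equality)
    have "inv_into UNIV g \<circ> g = id"
      using that H(1) symmetries_bij by (simp add: bij_is_inj subset_iff)
    then show "lift (inv_into UNIV g) \<otimes>\<^bsub>Aut X\<^esub> lift g = \<one>\<^bsub>Aut X\<^esub>"
      using lift_mult[of "inv_into UNIV g" g] that H lift_one by auto
  qed (use that sub H(4) in auto)
  have "subgroup (lift ` H) (Aut X)"
  proof
    show "lift ` H \<subseteq> carrier (Aut X)" using sub by simp
    show "\<one>\<^bsub>Aut X\<^esub> \<in> lift ` H" using lift_one H(2) by (metis imageI)
    show "x \<otimes>\<^bsub>Aut X\<^esub> y \<in> lift ` H" if "x \<in> lift ` H" "y \<in> lift ` H" for x y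
      using that H lift_mult by (auto simp: subset_iff)
    show "inv\<^bsub>Aut X\<^esub> x \<in> lift ` H" if "x \<in> lift ` H" for x
      using that inv H(4) by auto
  qed
  moreover have "acts_properly X (lift ` H)"
  proof (rule acts_properlyI[OF sub])
    fix v w
    have unique: "\<phi> = \<psi>" if mem: "\<phi> \<in> lift ` H" "\<psi> \<in> lift ` H" "shadow \<phi> v = w" "shadow \<psi> v = w" for \<phi> \<psi>
    proof -
      obtain g h where gh: "g \<in> H" "h \<in> H" "\<phi> = lift g" "\<psi> = lift h" using mem(1,2) by blast
      have bij: "bij h" using gh(2) H(1) symmetries_bij by blast
      have "(inv_into UNIV h \<circ> g) v = v"
        using mem(3,4) gh bij by (simp add: bij_is_inj inv_f_eq)
      moreover have "inv_into UNIV h \<circ> g \<in> H" using gh(1,2) by (intro H(3,4))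
      ultimately have "inv_into UNIV h \<circ> g = id" using free by blast
      then have "h \<circ> (inv_into UNIV h \<circ> g) = h" by simp
      then have "g = h" using bij by (simp add: fun_eq_iff bij_is_surj surj_f_inv_f)
      then show ?thesis using gh by simp
    qed
    show "finite {\<phi> \<in> lift ` H. shadow \<phi> v = w}" (is "finite ?A")
    proof (cases "?A = {}")
      case False
      then obtain \<psi> where \<psi>: "\<psi> \<in> lift ` H" "shadow \<psi> v = w" by blast
      have "?A \<subseteq> {\<psi>}"
      proof
        fix \<phi> assume "\<phi> \<in> ?A"
        then show "\<phi> \<in> {\<psi>}" using unique[of \<phi> \<psi>] \<psi> by simp
      qed
      then show ?thesis by (rule finite_subset) simp
    next
      case True
      then show ?thesis by (simp only: finite.emptyI)
    qed
  qed
  moreover have "acts_cocompactly X (lift ` H)"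
  proof (rule acts_cocompactlyI[OF sub cofinite(1)])
    fix v
    obtain r g where "r \<in> R" "g \<in> H" "g r = v" using cofinite(2) by blast
    then show "\<exists>r\<in>R. \<exists>\<phi>\<in>lift ` H. shadow \<phi> r = v"
      by (intro bexI[of _ r] bexI[of _ "lift g"]) auto
  qed
  moreover have "acts_freely X (lift ` H)"
  proof (rule acts_freelyI[OF sub])
    fix \<phi> v assume "\<phi> \<in> lift ` H"
    then obtain g where g: "g \<in> H" "\<phi> = lift g" by blast
    show "\<phi> = \<one>\<^bsub>Aut X\<^esub>" if "shadow \<phi> v = v"
      using free[OF g(1), of v] that g(2) lift_one by simp
    show "shadow \<phi> (shadow \<phi> v) \<noteq> v" if "{v, shadow \<phi> v} \<in> edges T"
      using no_inversion[OF g(1), of v] that g(2) by simp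
  qed
  ultimately show ?thesis by (simp add: free_uniform_lattice_def uniform_lattice_def)
qed

end

section \<open>Reduced words and a twisted relabelling\<close>

type_synonym letter = "bool \<times> bool"

definition flip :: "letter \<Rightarrow> letter" where "flip d = (fst d, \<not> snd d)"

lemma flip_flip [simp]: "flip (flip d) = d"
  by (simp add: flip_def)

lemma flip_Pair [simp]: "flip (x, b) = (x, \<not> b)"
  by (simp add: flip_def)

lemma flip_neq [simp]: "flip d \<noteq> d" "d \<noteq> flip d"
  by (cases d; simp)+

lemma flip_eq_flip_iff [simp]: "flip d = flip e \<longleftrightarrow> d = e"
  by (metis flip_flip)

fun reduced :: "letter list \<Rightarrow> bool" where
  "reduced [] = True"
| "reduced (d # w) = (reduced w \<and> (w \<noteq> [] \<longrightarrow> hd w \<noteq> flip d))"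

text \<open>
  Words are stored with the last letter first: \<open>step d w\<close> is the reduced form of the word \<open>w\<close>
  multiplied by \<open>d\<close> on the right. A letter is a generator with a sign, \<open>True\<close> for the
  generator and \<open>False\<close> for its inverse.
\<close>

definition step :: "letter \<Rightarrow> letter list \<Rightarrow> letter list" where
  "step d w = (if w \<noteq> [] \<and> hd w = flip d then tl w else d # w)"

lemma step_Nil [simp]: "step d [] = [d]"
  by (simp add: step_def)

lemma step_Cons: "step d (e # w) = (if e = flip d then w else d # e # w)"
  by (simp add: step_def)

lemma reduced_step [simp]: "reduced w \<Longrightarrow> reduced (step d w)"
  by (cases w) (auto simp: step_def)

lemma step_flip_step [simp]: "reduced w \<Longrightarrow> step (flip d) (step d w) = w"
  by (cases w; cases "tl w") (auto simp: step_def)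

lemma step_reduced_Cons: "reduced (d # w) \<Longrightarrow> step d w = d # w"
  by (auto simp: step_def)

lemma sum_list_step:
  fixes val :: "letter \<Rightarrow> int"
  assumes "\<And>d. val (flip d) = - val d"
  shows "sum_list (map val (step d w)) = sum_list (map val w) + val d"
  using assms[of d] by (cases w) (auto simp: step_def)

definition level_value :: "letter \<Rightarrow> int" where
  "level_value d = (if snd d then 1 else - 1)"

text \<open>
  The values 1 and 2 of the generators, read modulo 3, give a vertex and its two out-neighbours
  three different colours.
\<close>

definition colour_value :: "letter \<Rightarrow> int" where
  "colour_value d = level_value d * (if fst d then 2 else 1)"

definition word_level :: "letter list \<Rightarrow> int" where
  "word_level w = sum_list (map level_value w)"

definition word_colour :: "letter list \<Rightarrow> int" where
  "word_colour w = sum_list (map colour_value w) mod 3"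

lemma word_level_step: "word_level (step d w) = word_level w + level_value d"
  unfolding word_level_def by (rule sum_list_step) (simp add: level_value_def flip_def)

lemma colour_value_flip: "colour_value (flip d) = - colour_value d"
  unfolding colour_value_def level_value_def flip_def by (cases "fst d"; cases "snd d"; simp)

lemma word_colour_step: "word_colour (step d w) = (word_colour w + colour_value d) mod 3"
  unfolding word_colour_def sum_list_step[where val = colour_value, OF colour_value_flip]
  by (rule mod_add_left_eq[symmetric])

text \<open>
  \<open>bend w\<close> says whether the labels of the out-edges at \<open>w\<close> are to be exchanged. Two conditions are
  imposed. At the two in-neighbours of a vertex the values agree (\<open>bend_in\<close>), because the labels of
  the two edges into that vertex have to stay different. At a vertex and its two out-neighbours the
  sum of the values is 1 or 0 according to the colour (\<open>bend_out\<close>). Walking away from the empty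
  word, a new vertex is constrained only if another in-neighbour or out-neighbour of its parent is
  already known or has been chosen; the remaining values are set to \<open>False\<close>. In the second and
  fourth equation \<open>w\<close> is that other neighbour of the parent, reached before it.
\<close>

fun bend :: "letter list \<Rightarrow> bool" where
  "bend [] = False"
| "bend ((x, True) # (y, False) # w) =
     ((word_colour ((y, False) # w) = 0) \<noteq> (bend ((y, False) # w) \<noteq> bend w))"
| "bend ((x, True) # w) = (x \<and> (bend w \<noteq> (word_colour w = 0)))"
| "bend ((x, False) # (y, True) # w) = bend w"
| "bend ((x, False) # w) = False"

lemma letter_list_cases:
  obtains "w = []" | y v where "w = (y, True) # v" | y v where "w = (y, False) # v"
  by (metis (full_types) list.exhaust prod.exhaust)

lemma bend_in:
  assumes "reduced w"
  shows "bend (step (x, False) w) = bend (step (y, False) w)"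
proof (cases w rule: letter_list_cases)
  case (2 z v)
  have "bend (step (x, False) w) = bend v" for x
    by (cases "x = z") (auto simp: 2 step_Cons)
  then show ?thesis by blast
next
  case (3 z v)
  have "bend (step (x, False) w) = False" for x
    by (auto simp: 3 step_Cons)
  then show ?thesis by blast
qed auto

lemma bend_out:
  assumes "reduced w"
  shows "(bend w \<noteq> (bend (step (False, True) w) \<noteq> bend (step (True, True) w)))
    \<longleftrightarrow> word_colour w = 0"
proof (cases w rule: letter_list_cases)
  case 1
  then show ?thesis by simp
next
  case (2 z v)
  then show ?thesis by (auto simp: step_Cons)
next
  case (3 z v)
  have "(bend (step (False, True) w) \<noteq> bend (step (True, True) w)) \<longleftrightarrow>
    (bend v \<noteq> ((word_colour w = 0) \<noteq> (bend w \<noteq> bend v)))"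
    by (cases z) (auto simp: 3 step_Cons)
  then show ?thesis by auto
qed

text \<open>
  The letter that replaces \<open>d\<close> in a step from \<open>w\<close>. The label of an edge is changed according to the
  start of the edge, which is \<open>step d w\<close> when \<open>d\<close> is an inverse letter.
\<close>

definition turn :: "letter list \<Rightarrow> letter \<Rightarrow> letter" where
  "turn w d = (if snd d then (fst d \<noteq> bend w, True) else (fst d \<noteq> bend (step d w), False))"

fun relabel :: "letter list \<Rightarrow> letter list" where
  "relabel [] = []"
| "relabel (d # w) = turn w d # relabel w"

lemma turn_inj: "reduced w \<Longrightarrow> turn w d = turn w e \<Longrightarrow> d = e"
  using bend_in[of w] by (cases d; cases e) (auto simp: turn_def split: if_splits)

lemma turn_surj:
  assumes "reduced w"
  obtains d where "turn w d = e"
proof (cases e)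
  case (Pair x b)
  show thesis
  proof (cases b)
    case True
    then show thesis using that[of "(x \<noteq> bend w, True)"] Pair by (auto simp: turn_def)
  next
    case False
    let ?d = "(x \<noteq> bend (step (x, False) w), False)"
    have "turn w ?d = e"
      using bend_in[OF assms, of x "x \<noteq> bend (step (x, False) w)"] Pair False
      by (auto simp: turn_def)
    then show thesis using that by blast
  qed
qed

lemma turn_flip:
  assumes "reduced w" shows "turn (step d w) (flip d) = flip (turn w d)"
  using step_flip_step[OF assms, of d] by (cases d) (auto simp: turn_def)

lemma hd_relabel:
  assumes "reduced (e # w)"
  shows "hd (relabel (e # w)) = flip (turn (e # w) (flip e))"
  using turn_flip[of w e] step_reduced_Cons[OF assms] assms by simp

lemma relabel_Nil_iff [simp]: "relabel w = [] \<longleftrightarrow> w = []"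
  by (cases w) auto

text \<open>
  Cancellation happens before relabelling if and only if it happens afterwards; this makes
  \<open>relabel\<close> an automorphism of the unlabelled tree.
\<close>

lemma hd_relabel_eq:
  assumes "reduced w" "w \<noteq> []"
  shows "hd (relabel w) = flip (turn w d) \<longleftrightarrow> hd w = flip d"
proof -
  obtain e v where w: "w = e # v" using assms(2) by (cases w) auto
  have "hd (relabel w) = flip (turn w (flip e))"
    using hd_relabel assms(1) unfolding w by blast
  then show ?thesis using turn_inj[OF assms(1), of "flip e" d] w by auto
qed

lemma reduced_relabel: "reduced w \<Longrightarrow> reduced (relabel w)"
proof (induction w)
  case (Cons d w)
  then have "reduced w" "reduced (relabel w)" "w \<noteq> [] \<Longrightarrow> hd w \<noteq> flip d" by simp_all
  then show ?case using hd_relabel_eq[of w d] by simp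
qed simp

lemma relabel_step:
  assumes "reduced w" shows "relabel (step d w) = step (turn w d) (relabel w)"
proof (cases "w \<noteq> [] \<and> hd w = flip d")
  case True
  then show ?thesis using hd_relabel_eq[OF assms, of d] by (cases w) (auto simp: step_def)
next
  case False
  then show ?thesis using hd_relabel_eq[OF assms, of d] by (auto simp: step_def)
qed

lemma relabel_inj: "reduced u \<Longrightarrow> reduced w \<Longrightarrow> relabel u = relabel w \<Longrightarrow> u = w"
proof (induction u arbitrary: w)
  case Nil
  then show ?case by (cases w) auto
next
  case (Cons d u)
  from Cons.prems(3) obtain e v where w: "w = e # v" by (cases w) simp_all
  have red: "reduced u" "reduced v" using Cons.prems(1,2) unfolding w by simp_all
  have eq: "turn u d = turn v e" "relabel u = relabel v" using Cons.prems(3) unfolding w by simp_all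
  have "u = v" by (rule Cons.IH[OF red eq(2)])
  with eq(1) turn_inj[OF red(2), of d e] show ?case unfolding w by simp
qed

lemma relabel_surj: "reduced u \<Longrightarrow> \<exists>w. reduced w \<and> relabel w = u"
proof (induction u)
  case Nil
  then show ?case by (intro exI[of _ "[]"]) auto
next
  case (Cons e u)
  then obtain w where w: "reduced w" "relabel w = u" by auto
  obtain d where d: "turn w d = e" using turn_surj[OF w(1)] by blast
  have "reduced (d # w)"
    using Cons.prems w d hd_relabel_eq[OF w(1), of d] by auto
  then show ?case using w d by (intro exI[of _ "d # w"]) auto
qed

lemma infinite_reduced: "infinite (Collect reduced)"
proof
  assume fin: "finite (Collect reduced)"
  have "reduced (replicate n (False, True))" for n
    by (induction n) (auto simp: hd_replicate)
  then have "range (\<lambda>n. replicate n (False, True)) \<subseteq> Collect reduced" by auto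
  moreover have "inj (\<lambda>n. replicate n (False, True))"
    by (auto intro: injI dest: arg_cong[where f = length])
  ultimately show False
    using fin finite_subset range_inj_infinite by blast
qed

section \<open>The free group on the natural numbers\<close>

definition word :: "nat \<Rightarrow> letter list" where
  "word = from_nat_into (Collect reduced)"

definition vertex :: "letter list \<Rightarrow> nat" where
  "vertex = to_nat_on (Collect reduced)"

lemma reduced_word [simp]: "reduced (word v)"
  using from_nat_into[of "Collect reduced"] infinite_reduced unfolding word_def by fastforce

lemma vertex_word [simp]: "vertex (word v) = v"
  unfolding word_def vertex_def using infinite_reduced
  by (intro to_nat_on_from_nat_into_infinite) auto

lemma word_vertex [simp]: "reduced w \<Longrightarrow> word (vertex w) = w"
  unfolding word_def vertex_def by (intro from_nat_into_to_nat_on) auto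

definition move :: "letter \<Rightarrow> nat \<Rightarrow> nat" where
  "move d v = vertex (step d (word v))"

abbreviation out :: "bool \<Rightarrow> nat \<Rightarrow> nat" where "out x \<equiv> move (x, True)"

definition origin :: nat where "origin = vertex []"

lemma word_move [simp]: "word (move d v) = step d (word v)"
  by (simp add: move_def)

lemma word_origin [simp]: "word origin = []"
  by (simp add: origin_def)

lemma move_flip_move [simp]: "move (flip d) (move d v) = v"
  by (simp add: move_def)

lemma move_move_flip [simp]: "move d (move (flip d) v) = v"
  using move_flip_move[of "flip d" v] by simp

lemma move_eq_iff [simp]: "move d u = move d v \<longleftrightarrow> u = v"
  by (metis move_flip_move)

lemma move_induct [case_names origin move]:
  assumes "P origin" "\<And>d v. P v \<Longrightarrow> P (move d v)"
  shows "P v"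
proof -
  have "reduced w \<Longrightarrow> P (vertex w)" for w
  proof (induction w)
    case Nil
    then show ?case using assms(1) by (simp add: origin_def)
  next
    case (Cons d w)
    then have "vertex (d # w) = move d (vertex w)"
      using step_reduced_Cons[of d w] by (simp add: move_def)
    then show ?case using Cons assms(2) by simp
  qed
  then show ?thesis by (metis reduced_word vertex_word)
qed

text \<open>
  Left multiplication by \<open>k\<close>: the letters of \<open>v\<close> are multiplied to \<open>k\<close> on the right.
\<close>

definition translate :: "nat \<Rightarrow> nat \<Rightarrow> nat" where
  "translate k v = foldr move (word v) k"

lemma translate_origin [simp]: "translate k origin = k"
  by (simp add: translate_def)

lemma translate_move: "translate k (move d v) = move d (translate k v)"
proof (cases "word v \<noteq> [] \<and> hd (word v) = flip d")
  case True
  then obtain w where "word v = flip d # w" by (metis list.collapse)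
  then show ?thesis by (simp add: translate_def step_def)
qed (auto simp: translate_def step_def)

lemma commute_eq:
  assumes "\<And>d v. f (move d v) = move d (f v)" "\<And>d v. g (move d v) = move d (g v)"
    and "f origin = g origin"
  shows "f = g"
proof
  fix v show "f v = g v"
    by (induction v rule: move_induct) (simp_all add: assms)
qed

text \<open>
  Each \<open>translate k\<close> has a left inverse of the same kind, because maps that commute with right
  multiplication are determined by one value. Being a left inverse of its own left inverse, it is
  bijective.
\<close>

lemma translate_bij: "bij (translate k)"
proof -
  have left_inv: "\<exists>k'. translate k' \<circ> translate k = id" for k
  proof -
    have "\<exists>k'. translate k' k = origin"
    proof (induction k rule: move_induct)
      case origin
      show ?case by (rule exI[of _ origin]) simp
    next
      case (move d v)
      have "\<exists>k'. translate k' v = u" for u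
      proof (induction v arbitrary: u rule: move_induct)
        case (move d v)
        then obtain k' where "translate k' v = move (flip d) u" by blast
        then show ?case by (intro exI[of _ k']) (simp add: translate_move)
      qed auto
      then show ?case by (metis translate_move move_move_flip)
    qed
    then obtain k' where "translate k' k = origin" by blast
    then have "translate k' \<circ> translate k = id"
      by (intro commute_eq) (simp_all add: translate_move)
    then show ?thesis ..
  qed
  obtain k' where k': "translate k' \<circ> translate k = id" using left_inv by blast
  obtain k'' where k'': "translate k'' \<circ> translate k' = id" using left_inv by blast
  have "translate k'' = translate k"
    using k' k'' by (metis comp_assoc comp_id id_comp)
  then show ?thesis using k' k'' by (metis o_bij)
qed

definition level :: "nat \<Rightarrow> int" where "level v = word_level (word v)"
definition colour :: "nat \<Rightarrow> int" where "colour v = word_colour (word v)"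

lemma level_out [simp]: "level (out x v) = level v + 1"
  by (simp add: level_def word_level_step level_value_def)

lemma colour_move: "colour (move d v) = (colour v + colour_value d) mod 3"
  by (simp add: colour_def word_colour_step)

lemma colour_origin [simp]: "colour origin = 0"
  by (simp add: colour_def word_colour_def)

lemma colour_range: "colour v \<in> {0, 1, 2}"
proof -
  have "0 \<le> colour v \<and> colour v < 3"
    by (simp add: colour_def word_colour_def)
  then show ?thesis by auto
qed

definition twist :: "nat \<Rightarrow> nat" where
  "twist v = vertex (relabel (word v))"

definition twist_swap :: "nat \<Rightarrow> bool" where "twist_swap v = bend (word v)"

lemma twist_bij: "bij twist"
proof (rule bijI')
  fix u v
  show "twist u = twist v \<longleftrightarrow> u = v"
    by (metis twist_def relabel_inj reduced_relabel reduced_word vertex_word word_vertex)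
next
  fix u
  obtain w where "reduced w" "relabel w = word u" using relabel_surj reduced_word by blast
  then show "\<exists>v. u = twist v"
    by (intro exI[of _ "vertex w"]) (simp add: twist_def)
qed

lemma twist_out: "twist (out x v) = out (x \<noteq> twist_swap v) (twist v)"
  using relabel_step[of "word v" "(x, True)"]
  by (simp add: twist_def twist_swap_def move_def turn_def reduced_relabel)

lemma twist_swap_sum:
  "(twist_swap v \<noteq> (twist_swap (out False v) \<noteq> twist_swap (out True v)))
    \<longleftrightarrow> colour v = 0"
  using bend_out[of "word v"] by (simp add: twist_swap_def colour_def)


section \<open>Exchanging out-edges\<close>

definition swap :: "(nat \<Rightarrow> nat) \<Rightarrow> nat \<Rightarrow> bool" where
  "swap g v \<longleftrightarrow> g (out False v) \<noteq> out False (g v)"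

definition oriented :: "(nat \<Rightarrow> nat) \<Rightarrow> bool" where
  "oriented g \<longleftrightarrow> bij g \<and> (\<forall>v x. g (out x v) = out (x \<noteq> swap g v) (g v))"

text \<open>
  The sum in \<open>\<int>/2\<close> of the swaps at \<open>v\<close> and at its two out-neighbours; \<open>\<noteq>\<close> on truth values is
  addition in \<open>\<int>/2\<close> throughout.
\<close>

definition defect :: "(nat \<Rightarrow> nat) \<Rightarrow> nat \<Rightarrow> bool" where
  "defect g v \<longleftrightarrow> (swap g v \<noteq> (swap g (out False v) \<noteq> swap g (out True v)))"

lemma out_neq [simp]: "out x v \<noteq> v" "v \<noteq> out x v"
  by (auto dest: arg_cong[where f = level])

text \<open>
  By left translation it is enough to compare words at the origin.
\<close>

lemma out2_inj:
  assumes "out x (out j u) = out x' (out j' u)" shows "x = x' \<and> j = j'"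
proof -
  have "translate u (out x (out j origin)) = translate u (out x' (out j' origin))"
    using assms by (simp add: translate_move)
  then have "out x (out j origin) = out x' (out j' origin)"
    using translate_bij by (simp add: bij_is_inj inj_eq)
  then have "word (out x (out j origin)) = word (out x' (out j' origin))" by simp
  then show ?thesis by (simp add: step_Cons)
qed

lemma out3_inj:
  assumes "out x (out j (out i u)) = out x' (out j' (out i' u))" shows "x = x' \<and> j = j' \<and> i = i'"
proof -
  have "translate u (out x (out j (out i origin))) = translate u (out x' (out j' (out i' origin)))"
    using assms by (simp add: translate_move)
  then have "out x (out j (out i origin)) = out x' (out j' (out i' origin))"
    using translate_bij by (simp add: bij_is_inj inj_eq)
  then have "word (out x (out j (out i origin))) = word (out x' (out j' (out i' origin)))" by simp
  then show ?thesis by (simp add: step_Cons)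
qed

lemma out_inj: "out x u = out x' u \<Longrightarrow> x = x'"
  using out2_inj[of False x u False x'] by simp

lemma out_inj_iff [simp]: "out x u = out x' u \<longleftrightarrow> x = x'"
  using out_inj by auto

lemma orientedI:
  assumes "bij g" "\<And>v x. g (out x v) = out (x \<noteq> s v) (g v)"
  shows "oriented g" "swap g = s"
proof -
  show "swap g = s" using assms(2) by (auto simp: swap_def)
  then show "oriented g" using assms by (simp add: oriented_def)
qed

lemma oriented_out: "oriented g \<Longrightarrow> g (out x v) = out (x \<noteq> swap g v) (g v)"
  by (simp add: oriented_def)

lemma oriented_bij: "oriented g \<Longrightarrow> bij g"
  by (simp add: oriented_def)

lemma oriented_compose:
  assumes "oriented g" "oriented h"
  shows "oriented (g \<circ> h)" "swap (g \<circ> h) v \<longleftrightarrow> (swap g (h v) \<noteq> swap h v)"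
proof -
  have "(g \<circ> h) (out x v) = out (x \<noteq> (swap g (h v) \<noteq> swap h v)) ((g \<circ> h) v)" for x v
    using assms by (cases x; cases "swap h v"; simp add: oriented_out)
  note * = orientedI[OF bij_comp[OF oriented_bij[OF assms(2)] oriented_bij[OF assms(1)]] this]
  show "oriented (g \<circ> h)" by (rule *(1))
  show "swap (g \<circ> h) v \<longleftrightarrow> (swap g (h v) \<noteq> swap h v)" by (simp only: *(2))
qed

lemma oriented_id: "oriented id" "\<not> swap id v"
  by (simp_all add: oriented_def swap_def)

lemma oriented_inv:
  assumes "oriented g"
  shows "oriented (inv_into UNIV g)" "swap (inv_into UNIV g) (g v) \<longleftrightarrow> swap g v"
proof -
  let ?h = "inv_into UNIV g"
  note b = oriented_bij[OF assms]
  have hg: "?h (g v) = v" "g (?h v) = v" for v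
    using b by (simp_all add: bij_is_inj bij_is_surj surj_f_inv_f)
  have "?h (out x v) = out (x \<noteq> swap g (?h v)) (?h v)" for x v
  proof -
    have "g (out (x \<noteq> swap g (?h v)) (?h v)) = out x v"
      using oriented_out[OF assms, of "x \<noteq> swap g (?h v)" "?h v"] by (simp add: hg) (metis (full_types))
    then show ?thesis using hg(1) by metis
  qed
  note * = orientedI[OF bij_imp_bij_inv[OF b] this]
  show "oriented ?h" by (rule *(1))
  show "swap ?h (g v) \<longleftrightarrow> swap g v" by (simp only: *(2) hg)
qed

text \<open>
  The images of the two out-neighbours of \<open>v\<close> are those of \<open>g v\<close>, possibly in the other order,
  and a sum of two terms does not see the order.
\<close>

lemma oriented_sum_out:
  assumes "oriented g"
  shows "(P (g (out False v)) \<noteq> P (g (out True v))) \<longleftrightarrow> (P (out False (g v)) \<noteq> P (out True (g v)))"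
  using assms by (cases "swap g v") (auto simp: oriented_out)

text \<open>
  The cocycle identity for \<open>swap\<close> carries over to the sum.
\<close>

lemma defect_compose:
  assumes "oriented g" "oriented h"
  shows "defect (g \<circ> h) v \<longleftrightarrow> (defect g (h v) \<noteq> defect h v)"
  using oriented_sum_out[OF assms(2), of "swap g" v]
  unfolding defect_def oriented_compose(2)[OF assms] by argo

lemma defect_inv:
  assumes "oriented g" shows "defect (inv_into UNIV g) (g v) \<longleftrightarrow> defect g v"
proof -
  have "inv_into UNIV g \<circ> g = id" using oriented_bij[OF assms] by (simp add: bij_is_inj)
  moreover have "\<not> defect id v" by (simp add: defect_def oriented_id)
  ultimately show ?thesis
    using defect_compose[OF oriented_inv(1)[OF assms] assms, of v] by simp
qed

section \<open>Fins that leave exactly the automorphisms of zero defect\<close>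

definition F2_tree :: "nat cell_graph" where
  "F2_tree = \<lparr>verts = UNIV, edges = {{v, out x v} | v x. True}\<rparr>"

lemma F2_edge_iff: "{u, v} \<in> edges F2_tree \<longleftrightarrow> (\<exists>x. v = out x u \<or> u = out x v)"
  by (auto simp: F2_tree_def doubleton_eq_iff)

lemma F2_edge_out: "{v, out x v} \<in> edges F2_tree"
  by (auto simp: F2_edge_iff)

lemma F2_verts [simp]: "verts F2_tree = UNIV"
  by (simp add: F2_tree_def)

lemma F2_edge_move: "{u, v} \<in> edges F2_tree \<longleftrightarrow> (\<exists>d. v = move d u)"
proof
  assume "{u, v} \<in> edges F2_tree"
  then obtain x where "v = out x u \<or> u = out x v" unfolding F2_edge_iff by blast
  moreover have "v = move (x, False) u" if "u = out x v"
    using move_flip_move[of "(x, True)" v] that by simp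
  ultimately show "\<exists>d. v = move d u" by blast
next
  assume "\<exists>d. v = move d u"
  then obtain x b where v: "v = move (x, b) u" by auto
  have "v = out x u \<or> u = out x v"
    using v move_flip_move[of "(x, False)" u] by (cases b) simp_all
  then show "{u, v} \<in> edges F2_tree" unfolding F2_edge_iff by blast
qed

lemma F2_is_tree: "is_tree F2_tree"
proof -
  have graph: "is_graph F2_tree"
    by (auto simp: is_graph_def F2_tree_def)
  have "(v, origin) \<in> (adjacency F2_tree)\<^sup>*" for v
  proof (induction v rule: move_induct)
    case (move d v)
    have "{v, move d v} \<in> edges F2_tree" unfolding F2_edge_move by blast
    then have "(move d v, v) \<in> adjacency F2_tree" by (simp add: adjacency_def insert_commute)
    then show ?case using move by (rule converse_rtrancl_into_rtrancl)
  qed simp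
  then have "(u, v) \<in> (adjacency F2_tree)\<^sup>*" for u v
    using sym_rtrancl[OF sym_adjacency, of F2_tree] by (meson rtrancl_trans symD)
  moreover have "\<not> is_cycle F2_tree xs" for xs
  proof (rule no_cycle_by_depth[where depth = "\<lambda>v. length (word v)" and par = "\<lambda>v. vertex (tl (word v))"])
    fix u v assume "{u, v} \<in> edges F2_tree" and le: "length (word u) \<le> length (word v)"
    then obtain d where v: "v = move d u" using F2_edge_move by blast
    have "word v = d # word u" using le unfolding v by (cases "word u") (auto simp: step_Cons)
    then show "u = vertex (tl (word v))" by simp
  qed
  ultimately show ?thesis
    unfolding is_tree_def using graph rtrancl_walk[OF _ graph] by simp
qed

text \<open>
  The sets \<open>fork v\<close> are the only fins with three vertices; their middle vertices force automorphisms
  to respect the orientation.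
\<close>

definition fork :: "nat \<Rightarrow> nat set" where
  "fork v = {v, out False v, out True v}"

text \<open>
  Label the four vertices two steps out from \<open>v\<close> by \<open>(i, j)\<close>, for \<open>out j (out i v)\<close>. The
  map \<open>(i, j) \<mapsto> (1 + i, i + j)\<close> arranges them in a cycle of length four that alternates between the
  two branches. The fin \<open>clock v i j k\<close> with \<open>k = i + j\<close> is the path from \<open>(i, j)\<close> through \<open>v\<close>
  to its successor \<open>(1 + i, k)\<close>, together with the two out-neighbours of \<open>(i, j)\<close>, which
  distinguish the start from the end. A map that changes the labels by \<open>\<sigma>\<close>, \<open>\<sigma>0\<close> and \<open>\<sigma>1\<close> at
  \<open>v\<close>, \<open>v0\<close> and \<open>v1\<close> respects the cycle if and only if \<open>\<sigma> + \<sigma>0 + \<sigma>1 = 0\<close>.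
\<close>

definition clock :: "nat \<Rightarrow> bool \<Rightarrow> bool \<Rightarrow> bool \<Rightarrow> nat set" where
  "clock v i j k = {v, out i v, out (\<not> i) v, out j (out i v),
     out False (out j (out i v)), out True (out j (out i v)), out k (out (\<not> i) v)}"

definition F2_fins :: "nat set set" where
  "F2_fins = range fork \<union> {clock v i j (i \<noteq> j) | v i j. True}"

lemma clock_in_fins: "clock v i j (i \<noteq> j) \<in> F2_fins"
  unfolding F2_fins_def by blast

text \<open>
  Three applications contain every vertex whose fork or clock reaches a given vertex, which bounds the
  number of fins there.
\<close>

definition up :: "nat set \<Rightarrow> nat set" where
  "up W = W \<union> (\<Union>x. move (x, False) ` W)"

lemma up_out: assumes "out x w \<in> W" shows "w \<in> up W"
proof -
  have "w = move (x, False) (out x w)" using move_flip_move[of "(x, True)" w] by simp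
  then show ?thesis using assms unfolding up_def by blast
qed

lemma up_mono: "w \<in> W \<Longrightarrow> w \<in> up W"
  by (simp add: up_def)

lemma finite_up: "finite W \<Longrightarrow> finite (up W)"
  by (simp add: up_def)

lemma in_clockD: "v \<in> clock u i j k \<Longrightarrow> u \<in> up (up (up {v}))"
  unfolding clock_def by (auto intro: up_mono up_out)

lemma in_forkD: "v \<in> fork u \<Longrightarrow> u \<in> up (up (up {v}))"
  unfolding fork_def by (auto intro: up_mono up_out)

lemma connected_from_centre:
  assumes "\<And>w. w \<in> S \<Longrightarrow> (w, c) \<in> (adjacency G)\<^sup>*" "u \<in> S" "v \<in> S"
  shows "(u, v) \<in> (adjacency G)\<^sup>*"
proof -
  have "(c, v) \<in> (adjacency G)\<^sup>*"
    using assms(1)[OF assms(3)] by (rule symD[OF sym_rtrancl[OF sym_adjacency]])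
  with assms(1)[OF assms(2)] show ?thesis by (rule rtrancl_trans)
qed

lemma adjacency_out:
  assumes "out x w \<in> S" "w \<in> S" "(w, c) \<in> (adjacency (induced_subgraph F2_tree S))\<^sup>*"
  shows "(out x w, c) \<in> (adjacency (induced_subgraph F2_tree S))\<^sup>*"
proof -
  have "(out x w, w) \<in> adjacency (induced_subgraph F2_tree S)"
    using assms(1,2) F2_edge_out[of w x] by (simp add: adjacency_def insert_commute)
  then show ?thesis using assms(3) by (rule converse_rtrancl_into_rtrancl)
qed

lemma fork_connected: "u \<in> fork v \<Longrightarrow> (u, v) \<in> (adjacency (induced_subgraph F2_tree (fork v)))\<^sup>*"
proof -
  let ?S = "fork v"
  have mem: "v \<in> ?S" "out False v \<in> ?S" "out True v \<in> ?S" by (simp_all add: fork_def)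
  have "(v, v) \<in> (adjacency (induced_subgraph F2_tree ?S))\<^sup>*" by simp
  then show "u \<in> ?S \<Longrightarrow> (u, v) \<in> (adjacency (induced_subgraph F2_tree ?S))\<^sup>*"
    using mem adjacency_out[OF mem(2,1)] adjacency_out[OF mem(3,1)] by (auto simp: fork_def)
qed

lemma clock_connected:
  "u \<in> clock v i j k \<Longrightarrow> (u, v) \<in> (adjacency (induced_subgraph F2_tree (clock v i j k)))\<^sup>*"
proof -
  let ?S = "clock v i j k" and ?R = "(adjacency (induced_subgraph F2_tree (clock v i j k)))\<^sup>*"
  have mem: "v \<in> ?S" "out i v \<in> ?S" "out (\<not> i) v \<in> ?S" "out j (out i v) \<in> ?S"
    "out False (out j (out i v)) \<in> ?S" "out True (out j (out i v)) \<in> ?S" "out k (out (\<not> i) v) \<in> ?S"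
    by (simp_all add: clock_def)
  have 0: "(v, v) \<in> ?R" by simp
  have 1: "(out i v, v) \<in> ?R" "(out (\<not> i) v, v) \<in> ?R"
    using adjacency_out[OF mem(2,1) 0] adjacency_out[OF mem(3,1) 0] by simp_all
  have 2: "(out j (out i v), v) \<in> ?R" "(out k (out (\<not> i) v), v) \<in> ?R"
    using adjacency_out[OF mem(4,2) 1(1)] adjacency_out[OF mem(7,3) 1(2)] by simp_all
  have 3: "(out False (out j (out i v)), v) \<in> ?R" "(out True (out j (out i v)), v) \<in> ?R"
    using adjacency_out[OF mem(5,4) 2(1)] adjacency_out[OF mem(6,4) 2(1)] by simp_all
  assume "u \<in> ?S"
  then have "u \<in> {v, out i v, out (\<not> i) v, out j (out i v),
     out False (out j (out i v)), out True (out j (out i v)), out k (out (\<not> i) v)}"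
    by (simp only: clock_def)
  then show "(u, v) \<in> ?R" using 0 1 2 3 by (elim insertE emptyE) (simp_all only:)
qed

interpretation F2: finned_tree F2_tree F2_fins
proof
  show "is_tree F2_tree" by (rule F2_is_tree)
  show "verts F2_tree = UNIV" by simp
  fix S assume "S \<in> F2_fins"
  then consider v where "S = fork v" | v i j k where "S = clock v i j k"
    by (auto simp: F2_fins_def)
  note S_cases = this
  show "finite S" by (rule S_cases) (simp_all add: fork_def clock_def)
  show "S \<noteq> {}" by (rule S_cases) (auto simp: fork_def clock_def)
  show "(u, v) \<in> (adjacency (induced_subgraph F2_tree S))\<^sup>*" if uv: "u \<in> S" "v \<in> S" for u v
  proof (rule S_cases)
    fix w assume S: "S = fork w"
    show ?thesis
      unfolding S by (rule connected_from_centre[OF fork_connected uv[unfolded S]])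
  next
    fix w i j k assume S: "S = clock w i j k"
    show ?thesis
      unfolding S by (rule connected_from_centre[OF clock_connected uv[unfolded S]])
  qed
next
  fix v
  let ?U = "up (up (up {v}))"
  have "{S \<in> F2_fins. v \<in> S} \<subseteq> fork ` ?U \<union> (\<lambda>(u, i, j). clock u i j (i \<noteq> j)) ` (?U \<times> UNIV \<times> UNIV)"
  proof
    fix S assume "S \<in> {S \<in> F2_fins. v \<in> S}"
    then consider u where "S = fork u" "v \<in> fork u"
      | u i j where "S = clock u i j (i \<noteq> j)" "v \<in> clock u i j (i \<noteq> j)"
      by (auto simp: F2_fins_def)
    then show "S \<in> fork ` ?U \<union> (\<lambda>(u, i, j). clock u i j (i \<noteq> j)) ` (?U \<times> UNIV \<times> UNIV)"
    proof cases
      case 1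
      then show ?thesis using in_forkD by blast
    next
      case 2
      then have "(u, i, j) \<in> ?U \<times> UNIV \<times> UNIV" using in_clockD by auto
      then show ?thesis using 2(1) by (intro UnI2 image_eqI[of _ _ "(u, i, j)"]) auto
    qed
  qed
  moreover have "finite ?U" by (intro finite_up) simp
  then have "finite (fork ` ?U \<union> (\<lambda>(u, i, j). clock u i j (i \<noteq> j)) ` (?U \<times> UNIV \<times> UNIV))"
    by simp
  ultimately show "finite {S \<in> F2_fins. v \<in> S}"
    by (rule finite_subset)
  have "fork v \<in> F2_fins" "v \<in> fork v" by (simp_all add: F2_fins_def fork_def)
  then show "\<exists>S\<in>F2_fins. v \<in> S" by blast
next
  fix e assume "e \<in> edges F2_tree"
  then obtain v x where "e = {v, out x v}" by (auto simp: F2_tree_def)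
  then have "e \<subseteq> fork v" by (cases x) (auto simp: fork_def)
  moreover have "fork v \<in> F2_fins" by (simp add: F2_fins_def)
  ultimately show "\<exists>S\<in>F2_fins. e \<subseteq> S" by blast
qed

lemma fork_neq_clock: "fork u \<noteq> clock v i j k"
proof
  assume "fork u = clock v i j k"
  moreover have "v \<in> clock v i j k" "out False (out j (out i v)) \<in> clock v i j k"
    by (simp_all add: clock_def)
  ultimately have "v \<in> fork u" "out False (out j (out i v)) \<in> fork u" by simp_all
  moreover have "level u \<le> level w \<and> level w \<le> level u + 1" if "w \<in> fork u" for w
    using that by (auto simp: fork_def)
  ultimately have "level u \<le> level v" "level v + 3 \<le> level u + 1" by fastforce+
  then show False by simp
qed

lemma clock_level:
  assumes "w \<in> clock u i j k"
  shows "level u \<le> level w" "level w = level u \<Longrightarrow> w = u"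
    "level w = level u + 2 \<Longrightarrow> w = out j (out i u) \<or> w = out k (out (\<not> i) u)"
    "level w = level u + 3 \<Longrightarrow> \<exists>x. w = out x (out j (out i u))"
  using assms by (auto simp: clock_def)

lemma clock_inj:
  assumes eq: "clock u i j k = clock u' i' j' k'"
  shows "k = k' \<and> i = i' \<and> j = j'"
proof -
  have mem: "u \<in> clock u i j k" "out k (out (\<not> i) u) \<in> clock u i j k"
      "out False (out j (out i u)) \<in> clock u i j k" for u i j k
    by (simp_all add: clock_def)
  have "u \<in> clock u' i' j' k'" "u' \<in> clock u i j k"
    using eq mem(1) by metis+
  then have u: "u = u'" using clock_level(1,2) by (metis order_antisym)
  have "out False (out j (out i u)) \<in> clock u i' j' k'"
    using eq mem(3) unfolding u by metis
  then obtain x where "out False (out j (out i u)) = out x (out j' (out i' u))"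
    using clock_level(4) by fastforce
  then have ij: "i = i'" "j = j'" using out3_inj by blast+
  have "out k (out (\<not> i) u) \<in> clock u i j k'"
    using eq mem(2) unfolding u ij by metis
  then have "out k (out (\<not> i) u) = out j (out i u) \<or> out k (out (\<not> i) u) = out k' (out (\<not> i) u)"
    using clock_level(3) by fastforce
  then have "k = k'" using out2_inj[of k "\<not> i" u j i] by auto
  then show ?thesis using ij by simp
qed

lemma image_fork: "oriented g \<Longrightarrow> g ` fork v = fork (g v)"
  by (cases "swap g v") (auto simp: fork_def oriented_out)

lemma image_clock:
  assumes "oriented g"
  shows "g ` clock v i j k =
    clock (g v) (i \<noteq> swap g v) (j \<noteq> swap g (out i v)) (k \<noteq> swap g (out (\<not> i) v))"
proof -
  have n: "((\<not> i) \<noteq> swap g v) \<longleftrightarrow> \<not> (i \<noteq> swap g v)" by auto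
  have "{out (False \<noteq> s) w, out (True \<noteq> s) w} = {out False w, out True w}" for s w
    by (cases s) auto
  then have last: "insert (out (False \<noteq> s) w) (insert (out (True \<noteq> s) w) A)
    = insert (out False w) (insert (out True w) A)" for s w A
    by (metis insert_commute insert_is_Un Un_insert_left)
  show ?thesis
    unfolding clock_def image_insert image_empty oriented_out[OF assms] n last ..
qed

lemma oriented_F2_symmetry:
  assumes g: "oriented g" and def: "\<And>v. \<not> defect g v"
  shows "e \<in> edges F2_tree \<Longrightarrow> g ` e \<in> edges F2_tree" "S \<in> F2_fins \<Longrightarrow> g ` S \<in> F2_fins"
proof -
  assume "e \<in> edges F2_tree"
  then obtain v x where "e = {v, out x v}" by (auto simp: F2_tree_def)
  then show "g ` e \<in> edges F2_tree" using F2_edge_out by (simp add: oriented_out[OF g])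
next
  assume "S \<in> F2_fins"
  then consider v where "S = fork v" | v i j where "S = clock v i j (i \<noteq> j)"
    by (auto simp: F2_fins_def)
  then show "g ` S \<in> F2_fins"
  proof cases
    case 1
    then show ?thesis using image_fork[OF g] by (simp add: F2_fins_def)
  next
    case 2
    have eq: "((i \<noteq> j) \<noteq> swap g (out (\<not> i) v)) \<longleftrightarrow> ((i \<noteq> swap g v) \<noteq> (j \<noteq> swap g (out i v)))"
      using def[of v] unfolding defect_def by (cases i) auto
    show ?thesis
      unfolding 2 image_clock[OF g] eq by (rule clock_in_fins)
  qed
qed

text \<open>
  Forks have three vertices and clocks have more, so forks go to forks, and middle vertices to middle
  vertices because the two ends of a fork are not adjacent; this gives the orientation. The
  image of a clock is then known up to a wrong last label, and the defect measures that error.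
\<close>

lemma F2_symmetries_iff:
  "g \<in> symmetries F2_tree F2_fins \<longleftrightarrow> oriented g \<and> (\<forall>v. \<not> defect g v)"
proof
  assume g: "g \<in> symmetries F2_tree F2_fins"
  have bij: "bij g" and edge: "\<And>e. g ` e \<in> edges F2_tree \<longleftrightarrow> e \<in> edges F2_tree"
    and fin: "\<And>S. g ` S \<in> F2_fins \<longleftrightarrow> S \<in> F2_fins"
    using g by (auto simp: symmetries_def)
  have inj: "g a = g b \<longleftrightarrow> a = b" for a b using bij by (simp add: bij_is_inj inj_eq)
  have fork: "g ` fork v = fork (g v)" for v
  proof -
    have card3: "card (fork w) = 3" for w by (simp add: fork_def)
    have "g ` fork v \<in> F2_fins" unfolding fin by (simp add: F2_fins_def)
    moreover have "g ` fork v \<noteq> clock w i j k" for w i j k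
    proof
      assume eq: "g ` fork v = clock w i j k"
      have "card (g ` fork v) = 3"
        using card3 card_image[OF inj_on_subset[OF bij_is_inj[OF bij]], of "fork v"] by simp
      moreover have "{w, out i w, out (\<not> i) w, out j (out i w)} \<subseteq> clock w i j k" by (auto simp: clock_def)
      then have "card {w, out i w, out (\<not> i) w, out j (out i w)} \<le> card (clock w i j k)"
        by (intro card_mono) (simp_all add: clock_def)
      moreover have "out j (out i w) \<noteq> w" "out j (out i w) \<noteq> out (\<not> i) w"
        by (auto dest: arg_cong[where f = level])
      then have "card {w, out i w, out (\<not> i) w, out j (out i w)} = 4"
        by (auto simp: card_insert_if)
      ultimately show False using eq by simp
    qed
    ultimately obtain w where w: "g ` fork v = fork w" by (auto simp: F2_fins_def)
    have "g v = w"
    proof (rule ccontr)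
      assume neq: "g v \<noteq> w"
      have "g v \<in> fork w" using w by (auto simp: fork_def)
      then obtain i where i: "g v = out i w" using neq by (auto simp: fork_def)
      have "out (\<not> i) w \<in> fork w" by (cases i) (auto simp: fork_def)
      then obtain z where z: "z \<in> fork v" "g z = out (\<not> i) w" using w by (metis imageE)
      then have "z \<noteq> v" using i by auto
      then have "{v, z} \<in> edges F2_tree" using z(1) F2_edge_out by (auto simp: fork_def)
      then have "{out i w, out (\<not> i) w} \<in> edges F2_tree" using edge[of "{v, z}"] i z(2) by simp
      then show False unfolding F2_edge_iff by (auto dest: arg_cong[where f = level])
    qed
    then show ?thesis using w by simp
  qed
  have "\<exists>y. g (out x v) = out y (g v)" for x v
  proof -
    have "out x v \<in> fork v" by (cases x) (auto simp: fork_def)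
    then have "g (out x v) \<in> fork (g v)" using fork by blast
    moreover have "g (out x v) \<noteq> g v" by (simp add: inj)
    ultimately show ?thesis by (auto simp: fork_def)
  qed
  then obtain y where y: "\<And>x v. g (out x v) = out (y x v) (g v)" by metis
  have yinj: "y True v \<noteq> y False v" for v
    using inj[of "out True v" "out False v"] y by auto
  have "g (out x v) = out (x \<noteq> y False v) (g v)" for x v
    using y[of x v] yinj[of v] by (cases x) auto
  then have or: "oriented g" by (rule orientedI(1)[OF bij])
  moreover have "\<not> defect g v" for v
  proof -
    have "clock v False False False \<in> F2_fins"
      using clock_in_fins[of v False False] by simp
    then have "g ` clock v False False False \<in> F2_fins" by (simp add: fin)
    then obtain w i j where
      "clock (g v) (swap g v) (swap g (out False v)) (swap g (out True v)) = clock w i j (i \<noteq> j)"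
      unfolding F2_fins_def image_clock[OF or] using fork_neq_clock by fastforce
    from clock_inj[OF this] show ?thesis by (auto simp: defect_def)
  qed
  ultimately show "oriented g \<and> (\<forall>v. \<not> defect g v)" by blast
next
  assume g: "oriented g \<and> (\<forall>v. \<not> defect g v)"
  let ?h = "inv_into UNIV g"
  have bij: "bij g" using g oriented_bij by blast
  have hg: "?h ` g ` A = A" for A
    using bij by (simp add: bij_is_inj image_inv_f_f)
  have def_h: "\<not> defect ?h v" for v
    using defect_inv[of g "?h v"] g bij by (simp add: bij_is_surj surj_f_inv_f)
  have or_h: "oriented ?h" using oriented_inv(1) g by blast
  have or: "oriented g" and def: "\<And>v. \<not> defect g v" using g by blast+
  have "g ` e \<in> edges F2_tree \<longleftrightarrow> e \<in> edges F2_tree" for e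
    using oriented_F2_symmetry(1)[OF or def, of e] oriented_F2_symmetry(1)[OF or_h def_h, of "g ` e"]
    unfolding hg by blast
  moreover have "g ` S \<in> F2_fins \<longleftrightarrow> S \<in> F2_fins" for S
    using oriented_F2_symmetry(2)[OF or def, of S] oriented_F2_symmetry(2)[OF or_h def_h, of "g ` S"]
    unfolding hg by blast
  ultimately show "g \<in> symmetries F2_tree F2_fins"
    using bij by (simp add: symmetries_def)
qed


section \<open>Odometers\<close>

lemma swap_funpow:
  assumes g: "oriented g" and fixed: "g v = v"
  shows "oriented (g ^^ n)" "(g ^^ n) v = v" "swap (g ^^ n) v \<longleftrightarrow> swap g v \<and> odd n"
proof -
  have "oriented (g ^^ n) \<and> (g ^^ n) v = v \<and> (swap (g ^^ n) v \<longleftrightarrow> swap g v \<and> odd n)"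
  proof (induction n)
    case 0
    show ?case using oriented_id unfolding funpow_0 funpow.simps(1) by (metis even_zero id_apply)
  next
    case (Suc n)
    then have n: "oriented (g ^^ n)" "(g ^^ n) v = v" "swap (g ^^ n) v \<longleftrightarrow> swap g v \<and> odd n"
      by blast+
    have "(g \<circ> g ^^ n) v = v" using n(2) fixed by simp
    moreover have "swap (g \<circ> g ^^ n) v \<longleftrightarrow> swap g v \<and> odd (Suc n)"
      unfolding oriented_compose(2)[OF g n(1)] n(2,3) by auto
    ultimately show ?case
      unfolding funpow.simps(2) using oriented_compose(1)[OF g n(1)] by blast
  qed
  then show "oriented (g ^^ n)" "(g ^^ n) v = v" "swap (g ^^ n) v \<longleftrightarrow> swap g v \<and> odd n" by auto
qed

text \<open>
  An odd power still exchanges the two out-edges at \<open>v\<close>. For an even power pass to \<open>g\<^sup>2\<close>, which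
  fixes \<open>out False v\<close> and exchanges the out-edges there, since the defect of \<open>g\<close> at \<open>v\<close> is zero.
\<close>

lemma odd_elliptic_infinite_order:
  assumes "oriented g" "\<And>v. \<not> defect g v" "g v = v" "swap g v" "0 < n"
  shows "g ^^ n \<noteq> id"
  using assms
proof (induction n arbitrary: g v rule: less_induct)
  case (less n)
  note g = less.prems(1)
  note pow = swap_funpow[OF g less.prems(3)]
  show ?case
  proof (cases "odd n")
    case True
    then have "swap (g ^^ n) v" using pow(3) less.prems(4) by blast
    then show ?thesis using oriented_id(2) by metis
  next
    case False
    then obtain m where m: "n = 2 * m" by auto
    let ?w = "out False v"
    have g2: "g ^^ 2 = g \<circ> g" by (simp add: numeral_2_eq_2)
    have gw: "g ?w = out True v"
      using oriented_out[OF g, of False v] less.prems(3,4) by simp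
    have "(g ^^ 2) ?w = ?w"
      using oriented_out[OF pow(1), of 2 False v] pow(2,3)[of 2] by simp
    moreover have "swap (g ^^ 2) ?w"
      using less.prems(2)[of v] less.prems(4) unfolding g2 oriented_compose(2)[OF g g] gw
      by (auto simp: defect_def)
    moreover have "\<not> defect (g ^^ 2) u" for u
      unfolding g2 defect_compose[OF g g] using less.prems(2) by simp
    moreover have "m < n" "0 < m" using m less.prems(5) by simp_all
    ultimately have "(g ^^ 2) ^^ m \<noteq> id"
      using less.IH pow(1)[of 2] by blast
    then show ?thesis unfolding m funpow_mult .
  qed
qed

text \<open>
  The powers of an element that fixes \<open>v\<close> lie in the finite stabiliser of \<open>v\<close>.
\<close>

lemma lattice_elliptic_even:
  assumes \<Lambda>: "uniform_lattice F2.X \<Lambda>" and \<phi>: "\<phi> \<in> \<Lambda>" and fixed: "F2.shadow \<phi> v = v"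
  shows "\<not> swap (F2.shadow \<phi>) v"
proof
  assume swap: "swap (F2.shadow \<phi>) v"
  let ?g = "F2.shadow \<phi>"
  interpret group "Aut F2.X" by (rule F2.group_X)
  have sub: "subgroup \<Lambda> (Aut F2.X)" using \<Lambda> by (simp add: uniform_lattice_def)
  then have aut: "\<And>\<psi>. \<psi> \<in> \<Lambda> \<Longrightarrow> \<psi> \<in> fin_auts F2.X"
    using subgroup.subset by fastforce
  have g: "oriented ?g" "\<And>v. \<not> defect ?g v"
    using F2.shadow_symmetries[OF aut[OF \<phi>]] unfolding F2_symmetries_iff by blast+
  have powers: "\<exists>\<psi>\<in>\<Lambda>. F2.shadow \<psi> = ?g ^^ n" for n
  proof (induction n)
    case 0
    show ?case using subgroup.one_closed[OF sub] F2.shadow_one unfolding funpow.simps(1) by blast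
  next
    case (Suc n)
    then obtain \<psi> where \<psi>: "\<psi> \<in> \<Lambda>" "F2.shadow \<psi> = ?g ^^ n" by blast
    then have "F2.shadow (\<phi> \<otimes>\<^bsub>Aut F2.X\<^esub> \<psi>) = ?g ^^ Suc n"
      unfolding funpow.simps(2) using F2.shadow_compose[OF aut[OF \<phi>] aut[OF \<psi>(1)]] by simp
    then show ?case using subgroup.m_closed[OF sub \<phi> \<psi>(1)] by blast
  qed
  have "range (\<lambda>n. ?g ^^ n) \<subseteq> F2.shadow ` {\<psi> \<in> \<Lambda>. F2.shadow \<psi> v = v}"
  proof (rule image_subsetI)
    fix n
    obtain \<psi> where \<psi>: "\<psi> \<in> \<Lambda>" "F2.shadow \<psi> = ?g ^^ n" using powers by blast
    then have "F2.shadow \<psi> v = v" using swap_funpow(2)[OF g(1) fixed] by simp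
    then show "?g ^^ n \<in> F2.shadow ` {\<psi> \<in> \<Lambda>. F2.shadow \<psi> v = v}"
      using \<psi> by (intro image_eqI[of _ _ \<psi>]) simp_all
  qed
  then have "finite (range (\<lambda>n. ?g ^^ n))"
    using F2.finite_stabiliser[OF \<Lambda>] by (meson finite_imageI finite_subset)
  then have "\<not> inj (\<lambda>n. ?g ^^ n)" using range_inj_infinite by blast
  then obtain a b where "a < b" "?g ^^ a = ?g ^^ b"
    by (metis (mono_tags, lifting) injI linorder_neqE_nat)
  then have "?g ^^ a \<circ> ?g ^^ (b - a) = ?g ^^ a"
    unfolding funpow_add[symmetric] by simp
  then have "(?g ^^ a) ((?g ^^ (b - a)) u) = (?g ^^ a) u" for u
    by (metis comp_apply)
  moreover have "inj (?g ^^ a)"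
    using swap_funpow(1)[OF g(1) fixed] oriented_bij bij_is_inj by blast
  ultimately have "?g ^^ (b - a) = id" by (intro ext) (simp add: inj_eq)
  then show False
    using odd_elliptic_infinite_order[OF g fixed swap, of "b - a"] \<open>a < b\<close> by simp
qed

section \<open>The two lattices\<close>

definition left_translations :: "(nat \<Rightarrow> nat) set" where
  "left_translations = {t. bij t \<and> (\<forall>d v. t (move d v) = move d (t v))}"

definition coloured_translations :: "(nat \<Rightarrow> nat) set" where
  "coloured_translations = {t \<in> left_translations. \<forall>v. colour (t v) = colour v}"

lemma left_translations_move: "t \<in> left_translations \<Longrightarrow> t (move d v) = move d (t v)"
  and left_translations_bij: "t \<in> left_translations \<Longrightarrow> bij t"
  unfolding left_translations_def by blast+

lemma left_translationsI: "bij t \<Longrightarrow> (\<And>d v. t (move d v) = move d (t v)) \<Longrightarrow> t \<in> left_translations"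
  unfolding left_translations_def by blast

lemma translate_left_translations: "translate k \<in> left_translations"
  by (intro left_translationsI translate_bij translate_move)

lemma left_translations_oriented:
  assumes "t \<in> left_translations" shows "oriented t" "\<not> swap t v" "\<not> defect t v"
proof -
  have "t (out x v) = out (x \<noteq> False) (t v)" for x v
    using left_translations_move[OF assms] by simp
  note * = orientedI[OF _ this]
  have "bij t" using assms by (rule left_translations_bij)
  then show "oriented t" "\<not> swap t v" "\<not> defect t v"
    using *(1) *(2) by (simp_all add: defect_def)
qed

lemma left_translations_compose: "s \<in> left_translations \<Longrightarrow> t \<in> left_translations \<Longrightarrow> s \<circ> t \<in> left_translations"
  by (intro left_translationsI bij_comp) (simp_all add: left_translations_move left_translations_bij)

lemma left_translations_inv:
  assumes "t \<in> left_translations" shows "inv_into UNIV t \<in> left_translations"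
proof -
  note b = left_translations_bij[OF assms] and comm = left_translations_move[OF assms]
  have "inv_into UNIV t (move d v) = move d (inv_into UNIV t v)" for d v
  proof -
    have "t (move d (inv_into UNIV t v)) = move d v"
      using b by (simp add: comm bij_is_surj surj_f_inv_f)
    then show ?thesis using b by (metis bij_is_inj inv_f_f)
  qed
  then show ?thesis by (intro left_translationsI bij_imp_bij_inv[OF b])
qed

text \<open>
  Commuting with all steps, a translation that fixes one vertex fixes every vertex.
\<close>

lemma left_translations_free:
  assumes t: "t \<in> left_translations" and "t v = v" shows "t = id"
proof -
  note comm = left_translations_move[OF t]
  have "t v = v \<longleftrightarrow> t origin = origin"
    by (induction v rule: move_induct) (simp_all add: comm)
  then show ?thesis using assms(2) comm by (intro commute_eq) auto
qed

lemma left_translations_transitive: "\<exists>t\<in>left_translations. t u = v"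
proof -
  let ?s = "inv_into UNIV (translate u)"
  have "?s u = origin" using translate_bij[of u] by (metis bij_is_inj inv_f_f translate_origin)
  then have "(translate v \<circ> ?s) u = v" by simp
  then show ?thesis
    using left_translations_compose[OF translate_left_translations left_translations_inv[OF translate_left_translations]]
    by blast
qed

text \<open>
  A translation changes all colours by the same amount, namely by the colour of the image of the
  origin.
\<close>

lemma colour_preserving:
  assumes t: "t \<in> left_translations" and "colour (t u) = colour u" shows "colour (t v) = colour v"
proof -
  note comm = left_translations_move[OF t]
  let ?c = "colour (t origin)"
  have shift: "colour (t v) = (colour v + ?c) mod 3" for v
  proof (induction v rule: move_induct)
    case origin
    show ?case using colour_range[of "t origin"] by auto
  next
    case (move d v)
    show ?case unfolding comm colour_move move
      by (simp add: mod_add_left_eq mod_add_right_eq add.commute add.left_commute)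
  qed
  have "?c = 0"
    using shift[of u] assms(2) colour_range[of u] colour_range[of "t origin"] by auto
  then show ?thesis using shift[of v] colour_range[of v] by auto
qed

lemma coloured_translations_transitive:
  assumes "colour u = colour v" shows "\<exists>t\<in>coloured_translations. t u = v"
proof -
  obtain t where t: "t \<in> left_translations" "t u = v" using left_translations_transitive by blast
  then have "colour (t w) = colour w" for w using colour_preserving[OF t(1), of u] assms by simp
  then have "t \<in> coloured_translations" using t(1) by (simp add: coloured_translations_def)
  then show ?thesis using t(2) by blast
qed

text \<open>
  The orientation of an inverted edge would be reversed.
\<close>

lemma oriented_no_inversion:
  assumes g: "oriented g" and "{v, g v} \<in> edges F2_tree" shows "g (g v) \<noteq> v"
proof
  assume eq: "g (g v) = v"
  obtain x where "g v = out x v \<or> v = out x (g v)" using assms(2) unfolding F2_edge_iff by blast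
  then show False
  proof
    assume "g v = out x v"
    then have "level (g (g v)) = level v + 2" using oriented_out[OF g, of x v] by simp
    then show False using eq by simp
  next
    assume v: "v = out x (g v)"
    then have "level (g v) = level v + 1" using oriented_out[OF g, of x "g v"] eq by (metis level_out)
    moreover have "level v = level (g v) + 1" using v by (metis level_out)
    ultimately show False by simp
  qed
qed

lemma left_translations_symmetries: "left_translations \<subseteq> symmetries F2_tree F2_fins"
  using left_translations_oriented F2_symmetries_iff by blast

lemma transitive_lattice: "free_uniform_lattice F2.X (F2.lift ` left_translations)"
proof (rule F2.free_uniform_lattice_lift[where R = "{origin}"])
  show "left_translations \<subseteq> symmetries F2_tree F2_fins" by (rule left_translations_symmetries)
  show "id \<in> left_translations" by (simp add: left_translationsI)
  show "g (g v) \<noteq> v" if "g \<in> left_translations" "{v, g v} \<in> edges F2_tree" for g v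
    using that left_translations_oriented(1) oriented_no_inversion by blast
  show "\<exists>r\<in>{origin}. \<exists>g\<in>left_translations. g r = v" for v
    using left_translations_transitive by blast
qed (simp_all add: left_translations_compose left_translations_inv left_translations_free)

lemma oriented_twist: "oriented twist" "swap twist = twist_swap"
  using orientedI[OF twist_bij twist_out] by blast+

lemma defect_twist: "defect twist v \<longleftrightarrow> colour v = 0"
  unfolding defect_def oriented_twist(2) by (rule twist_swap_sum)

definition twisted :: "(nat \<Rightarrow> nat) set" where
  "twisted = (\<lambda>t. twist \<circ> t \<circ> inv_into UNIV twist) ` coloured_translations"

lemma inv_twist [simp]: "inv_into UNIV twist (twist v) = v"
  "twist (inv_into UNIV twist v) = v"
  using twist_bij by (simp_all add: bij_is_inj bij_is_surj surj_f_inv_f)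

lemma twisted_symmetries: "twisted \<subseteq> symmetries F2_tree F2_fins"
proof
  fix g assume "g \<in> twisted"
  then obtain t where t: "t \<in> coloured_translations"
    and g: "g = twist \<circ> t \<circ> inv_into UNIV twist"
    by (auto simp: twisted_def)
  have tt: "t \<in> left_translations" and col: "\<And>v. colour (t v) = colour v"
    using t by (simp_all add: coloured_translations_def)
  note o1 = oriented_twist(1) and o2 = left_translations_oriented(1)[OF tt]
    and o3 = oriented_inv(1)[OF oriented_twist(1)]
  note o12 = oriented_compose(1)[OF o1 o2]
  have "\<not> defect g v" for v
  proof -
    obtain u where v: "v = twist u" by (metis inv_twist(2))
    show ?thesis
      unfolding g v defect_compose[OF o12 o3] defect_compose[OF o1 o2] defect_inv[OF o1]
      using left_translations_oriented(3)[OF tt] by (simp add: defect_twist col)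
  qed
  then show "g \<in> symmetries F2_tree F2_fins"
    unfolding F2_symmetries_iff g using oriented_compose(1)[OF o12 o3] by blast
qed

lemma twisted_lattice: "free_uniform_lattice F2.X (F2.lift ` twisted)"
proof (rule F2.free_uniform_lattice_lift[where R = "twist ` {origin, out False origin, out True origin}"])
  let ?k = "inv_into UNIV twist"
  show sym: "twisted \<subseteq> symmetries F2_tree F2_fins" by (rule twisted_symmetries)
  have "id \<in> coloured_translations" by (simp add: coloured_translations_def left_translationsI)
  moreover have "id = twist \<circ> id \<circ> ?k" by (simp add: fun_eq_iff)
  ultimately show "id \<in> twisted" unfolding twisted_def by blast
  show "g \<circ> h \<in> twisted" if gh: "g \<in> twisted" "h \<in> twisted" for g h
  proof -
    obtain s t where st: "s \<in> coloured_translations" "t \<in> coloured_translations"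
      "g = twist \<circ> s \<circ> ?k" "h = twist \<circ> t \<circ> ?k"
      using gh unfolding twisted_def by blast
    have "g \<circ> h = twist \<circ> (s \<circ> t) \<circ> ?k" by (simp add: st fun_eq_iff)
    moreover have "s \<circ> t \<in> coloured_translations"
      using st by (simp add: coloured_translations_def left_translations_compose)
    ultimately show ?thesis unfolding twisted_def by blast
  qed
  show "inv_into UNIV g \<in> twisted" if g: "g \<in> twisted" for g
  proof -
    obtain t where t: "t \<in> coloured_translations" "g = twist \<circ> t \<circ> ?k"
      using g unfolding twisted_def by blast
    have tt: "t \<in> left_translations" and col: "\<And>v. colour (t v) = colour v"
      using t(1) by (simp_all add: coloured_translations_def)
    let ?s = "inv_into UNIV t"
    have st: "t (?s v) = v" "?s (t v) = v" for v
      using left_translations_bij[OF tt] by (simp_all add: bij_is_surj bij_is_inj surj_f_inv_f)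
    have "colour (?s v) = colour v" for v using col[of "?s v"] by (simp add: st)
    then have "?s \<in> coloured_translations"
      using left_translations_inv[OF tt] by (simp add: coloured_translations_def)
    moreover have "inv_into UNIV g = twist \<circ> ?s \<circ> ?k"
      by (rule inv_unique_comp) (simp_all add: t(2) fun_eq_iff st)
    ultimately show ?thesis unfolding twisted_def by blast
  qed
  show "g = id" if g: "g \<in> twisted" "g v = v" for g v
  proof -
    obtain t where t: "t \<in> coloured_translations" "g = twist \<circ> t \<circ> ?k"
      using g(1) unfolding twisted_def by blast
    have "?k (twist (t (?k v))) = ?k v" using g(2) t(2) by simp
    then have "t (?k v) = ?k v" by simp
    then have "t = id" using t(1) left_translations_free by (auto simp: coloured_translations_def)
    then show ?thesis using t(2) by (simp add: fun_eq_iff)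
  qed
  show "g (g v) \<noteq> v" if "g \<in> twisted" "{v, g v} \<in> edges F2_tree" for g v
  proof -
    have "oriented g" using that(1) sym F2_symmetries_iff by blast
    then show ?thesis using that(2) by (rule oriented_no_inversion)
  qed
  show "finite (twist ` {origin, out False origin, out True origin})" by simp
  fix v
  have "\<exists>r\<in>{origin, out False origin, out True origin}. colour r = colour (?k v)"
    using colour_range[of "?k v"] by (auto simp: colour_move colour_value_def level_value_def)
  then obtain r where r: "r \<in> {origin, out False origin, out True origin}" "colour r = colour (?k v)"
    by blast
  obtain t where t: "t \<in> coloured_translations" "t r = ?k v"
    using coloured_translations_transitive[OF r(2)] by blast
  then have "(twist \<circ> t \<circ> ?k) (twist r) = v" by simp
  moreover have "twist \<circ> t \<circ> ?k \<in> twisted" using t(1) unfolding twisted_def by blast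
  ultimately show "\<exists>r\<in>twist ` {origin, out False origin, out True origin}. \<exists>g\<in>twisted. g r = v"
    using r(1) by blast
qed

section \<open>No common overlattice\<close>

text \<open>
  Here \<open>M\<close> is the action of a uniform lattice on the base tree. The function \<open>s\<close> compares the labels
  of the out-edges at a vertex with those at the origin, using any element of \<open>M\<close> between the
  two; pulled back along \<open>c' \<circ> twist\<close> it becomes a function \<open>f\<close> of the colour. The sum of
  \<open>f\<close> over the three colours is computed once at a vertex of colour 0 and once at a
  vertex of colour 1, where the defects of \<open>c' \<circ> twist\<close> differ.
\<close>

lemma no_common_overgroup:
  assumes M: "M \<subseteq> symmetries F2_tree F2_fins"
      "\<And>m n. m \<in> M \<Longrightarrow> n \<in> M \<Longrightarrow> m \<circ> n \<in> M" "\<And>m. m \<in> M \<Longrightarrow> inv_into UNIV m \<in> M"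
    and even: "\<And>m v. m \<in> M \<Longrightarrow> m v = v \<Longrightarrow> \<not> swap m v"
    and c: "c \<in> symmetries F2_tree F2_fins" "c' \<in> symmetries F2_tree F2_fins"
    and transitive: "\<And>t. t \<in> left_translations \<Longrightarrow> \<exists>m\<in>M. \<forall>v. m (c v) = c (t v)"
    and conj_twisted: "\<And>t. t \<in> coloured_translations \<Longrightarrow> \<exists>m\<in>M. \<forall>v. m (c' (twist v)) = c' (twist (t v))"
  shows False
proof -
  have or: "oriented m" and def: "\<not> defect m v" if "m \<in> M" for m v
    using that M(1) F2_symmetries_iff by blast+
  \<comment> \<open>Every vertex has the form \<open>c a\<close>, and translations are transitive.\<close>
  have M_transitive: "\<exists>m\<in>M. m origin = v" for v
  proof -
    have "surj c" using c(1) F2_symmetries_iff oriented_bij bij_is_surj by blast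
    then obtain a b where "origin = c a" "v = c b" by (metis surjD)
    then show ?thesis
      using left_translations_transitive[of a b] transitive by metis
  qed
  define s where "s v = swap (SOME m. m \<in> M \<and> m origin = v) origin" for v
  \<comment> \<open>Two elements with the same value at the origin differ by one that fixes the origin.\<close>
  have s: "s (m origin) = swap m origin" if m: "m \<in> M" for m
  proof -
    define n where "n = (SOME n. n \<in> M \<and> n origin = m origin)"
    have n: "n \<in> M \<and> n origin = m origin"
      unfolding n_def by (rule someI[of _ m]) (simp add: m)
    let ?i = "inv_into UNIV n"
    have bij: "bij n" using or n oriented_bij by blast
    have "(?i \<circ> m) origin = origin" using n bij by (metis comp_apply bij_is_inj inv_f_f)
    then have "\<not> swap (?i \<circ> m) origin" using even M n m by blast
    moreover have "swap (?i \<circ> m) origin \<longleftrightarrow> (swap ?i (n origin) \<noteq> swap m origin)"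
      using oriented_compose(2)[OF or[OF M(3)] or[OF m], of n origin] n by simp
    ultimately have "swap n origin = swap m origin"
      using oriented_inv(2)[OF or, of n origin] n by blast
    then show ?thesis by (simp add: s_def n_def)
  qed
  have s_equivariant: "s (m v) \<longleftrightarrow> (swap m v \<noteq> s v)" if m: "m \<in> M" for m v
  proof -
    obtain n where n: "n \<in> M" "n origin = v" using M_transitive by blast
    have "s ((m \<circ> n) origin) = swap (m \<circ> n) origin" using s[OF M(2)[OF m n(1)]] .
    then show ?thesis using oriented_compose(2)[OF or[OF m] or[OF n(1)], of origin] s[OF n(1)] n(2) by simp
  qed
  define \<kappa> where "\<kappa> \<longleftrightarrow> (s origin \<noteq> (s (out False origin) \<noteq> s (out True origin)))"
  have s_sum: "(s v \<noteq> (s (out False v) \<noteq> s (out True v))) \<longleftrightarrow> \<kappa>" for v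
  proof -
    obtain m where m: "m \<in> M" "m origin = v" using M_transitive by blast
    show ?thesis
      using oriented_sum_out[OF or[OF m(1)], of s origin] def[OF m(1), of origin]
        s_equivariant[OF m(1), of origin] s_equivariant[OF m(1), of "out False origin"]
        s_equivariant[OF m(1), of "out True origin"]
      unfolding m(2) \<kappa>_def defect_def by argo
  qed
  let ?H = "c' \<circ> twist"
  have c': "oriented c'" "\<And>v. \<not> defect c' v" using c(2) F2_symmetries_iff by blast+
  have H: "oriented ?H" "defect ?H v \<longleftrightarrow> colour v = 0" for v
    using oriented_compose(1)[OF c'(1) oriented_twist(1)]
      defect_compose[OF c'(1) oriented_twist(1)] c'(2) defect_twist by simp_all
  define f where "f v \<longleftrightarrow> (s (?H v) \<noteq> swap ?H v)" for v
  have f_colour: "f u = f v" if uv: "colour u = colour v" for u v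
  proof -
    obtain t where t: "t \<in> coloured_translations" "t u = v"
      using coloured_translations_transitive[OF uv] by blast
    have tt: "t \<in> left_translations" using t(1) by (simp add: coloured_translations_def)
    obtain m where m: "m \<in> M" "\<And>v. m (?H v) = ?H (t v)" using conj_twisted[OF t(1)] by auto
    have "m \<circ> ?H = ?H \<circ> t" using m(2) by (intro ext) (simp only: comp_apply)
    then have "swap (m \<circ> ?H) u = swap (?H \<circ> t) u" by (simp only:)
    then have "swap ?H v \<longleftrightarrow> (swap m (?H u) \<noteq> swap ?H u)"
      using oriented_compose(2)[OF or[OF m(1)] H(1), of u]
        oriented_compose(2)[OF H(1) left_translations_oriented(1)[OF tt], of u]
        left_translations_oriented(2)[OF tt, of u] unfolding t(2) by blast
    moreover have "s (?H v) \<longleftrightarrow> (swap m (?H u) \<noteq> s (?H u))"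
      using s_equivariant[OF m(1), of "?H u"] unfolding m(2) t(2) .
    ultimately show ?thesis unfolding f_def by argo
  qed
  have f_sum: "(f v \<noteq> (f (out False v) \<noteq> f (out True v))) \<longleftrightarrow> (\<kappa> \<noteq> (colour v = 0))" for v
    using oriented_sum_out[OF H(1), of s v] s_sum[of "?H v"] H(2)[of v]
    unfolding f_def defect_def by argo
  \<comment> \<open>The out-neighbours of the vertex \<open>?a\<close> of colour 1 have the colours 2 and 0.\<close>
  let ?a = "out False origin" and ?b = "out True origin"
  have cols: "colour ?a = 1" "colour ?b = 2" "colour (out False ?a) = 2" "colour (out True ?a) = 0"
    by (simp_all add: colour_move colour_value_def level_value_def)
  have "f (out False ?a) = f ?b" "f (out True ?a) = f origin"
    by (rule f_colour, simp add: cols)+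
  then show False using f_sum[of origin] f_sum[of ?a] cols by auto
qed

theorem theorem1p3:
  shows "\<exists>X :: (nat, nat, nat) fin_data.
    tree_with_fins X \<and> locally_finite (mapping_cylinder X) \<and>
    (\<exists>\<Gamma> \<Gamma>'. free_uniform_lattice X \<Gamma> \<and> free_uniform_lattice X \<Gamma>' \<and>
      \<not> (\<exists>\<Lambda>. uniform_lattice X \<Lambda> \<and>
             contains_conjugate (Aut X) \<Lambda> \<Gamma> \<and> contains_conjugate (Aut X) \<Lambda> \<Gamma>'))"
proof (intro exI conjI)
  show "tree_with_fins F2.X" by (rule F2.tree_with_fins_X)
  show "locally_finite (mapping_cylinder F2.X)" by (rule F2.locally_finite_X)
  show "free_uniform_lattice F2.X (F2.lift ` twisted)" by (rule twisted_lattice)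
  show "free_uniform_lattice F2.X (F2.lift ` left_translations)" by (rule transitive_lattice)
  show "\<not> (\<exists>\<Lambda>. uniform_lattice F2.X \<Lambda> \<and> contains_conjugate (Aut F2.X) \<Lambda> (F2.lift ` twisted) \<and>
    contains_conjugate (Aut F2.X) \<Lambda> (F2.lift ` left_translations))"
  proof (intro notI, elim exE conjE)
    fix \<Lambda>
    assume \<Lambda>: "uniform_lattice F2.X \<Lambda>"
      and tw: "contains_conjugate (Aut F2.X) \<Lambda> (F2.lift ` twisted)"
      and tr: "contains_conjugate (Aut F2.X) \<Lambda> (F2.lift ` left_translations)"
    have sub: "subgroup \<Lambda> (Aut F2.X)" using \<Lambda> by (simp add: uniform_lattice_def)
    then have aut: "\<And>\<psi>. \<psi> \<in> \<Lambda> \<Longrightarrow> \<psi> \<in> fin_auts F2.X"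
      using subgroup.subset by fastforce
    have conj: "\<exists>c\<in>symmetries F2_tree F2_fins. \<forall>g\<in>H. \<exists>m\<in>F2.shadow ` \<Lambda>. \<forall>v. m (c v) = c (g v)"
      if H_conj: "contains_conjugate (Aut F2.X) \<Lambda> (F2.lift ` H)" and H: "H \<subseteq> symmetries F2_tree F2_fins" for H
    proof -
      obtain \<gamma> where \<gamma>: "\<gamma> \<in> fin_auts F2.X"
        and "(\<gamma> <#\<^bsub>Aut F2.X\<^esub> (F2.lift ` H)) #>\<^bsub>Aut F2.X\<^esub> (inv\<^bsub>Aut F2.X\<^esub> \<gamma>) \<subseteq> \<Lambda>"
        using H_conj unfolding contains_conjugate_def F2.carrier_Aut by blast
      then have in_\<Lambda>: "\<gamma> \<otimes>\<^bsub>Aut F2.X\<^esub> F2.lift g \<otimes>\<^bsub>Aut F2.X\<^esub> inv\<^bsub>Aut F2.X\<^esub> \<gamma> \<in> \<Lambda>" if "g \<in> H" for g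
        using that unfolding l_coset_def r_coset_def by blast
      have "\<exists>m\<in>F2.shadow ` \<Lambda>. \<forall>v. m (F2.shadow \<gamma> v) = F2.shadow \<gamma> (g v)" if g: "g \<in> H" for g
      proof
        let ?\<psi> = "\<gamma> \<otimes>\<^bsub>Aut F2.X\<^esub> F2.lift g \<otimes>\<^bsub>Aut F2.X\<^esub> inv\<^bsub>Aut F2.X\<^esub> \<gamma>"
        show "F2.shadow ?\<psi> \<in> F2.shadow ` \<Lambda>" using in_\<Lambda>[OF g] by blast
        have lg: "F2.lift g \<in> fin_auts F2.X" using F2.lift_fin_auts g H by blast
        then have "\<gamma> \<otimes>\<^bsub>Aut F2.X\<^esub> F2.lift g \<in> fin_auts F2.X"
          using F2.group_X \<gamma> by (metis F2.carrier_Aut group.is_monoid monoid.m_closed)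
        then show "\<forall>v. F2.shadow ?\<psi> (F2.shadow \<gamma> v) = F2.shadow \<gamma> (g v)"
          using \<gamma> lg by (simp add: F2.shadow_compose F2.aut_inv(1) F2.shadow_inv(1))
      qed
      then show ?thesis using F2.shadow_symmetries[OF \<gamma>] by blast
    qed
    obtain c where c: "c \<in> symmetries F2_tree F2_fins"
      "\<And>t. t \<in> left_translations \<Longrightarrow> \<exists>m\<in>F2.shadow ` \<Lambda>. \<forall>v. m (c v) = c (t v)"
      using conj[OF tr left_translations_symmetries] by blast
    obtain c' where c': "c' \<in> symmetries F2_tree F2_fins"
      "\<And>g. g \<in> twisted \<Longrightarrow> \<exists>m\<in>F2.shadow ` \<Lambda>. \<forall>v. m (c' v) = c' (g v)"
      using conj[OF tw twisted_symmetries] by blast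
    show False
    proof (rule no_common_overgroup[OF _ _ _ _ c(1) c'(1) c(2)])
      show "F2.shadow ` \<Lambda> \<subseteq> symmetries F2_tree F2_fins"
        using F2.shadow_symmetries aut by blast
      show "m \<circ> n \<in> F2.shadow ` \<Lambda>" if "m \<in> F2.shadow ` \<Lambda>" "n \<in> F2.shadow ` \<Lambda>" for m n
        using that subgroup.m_closed[OF sub] F2.shadow_compose aut by (smt (verit) image_iff)
      show "inv_into UNIV m \<in> F2.shadow ` \<Lambda>" if m: "m \<in> F2.shadow ` \<Lambda>" for m
      proof -
        obtain \<psi> where \<psi>: "\<psi> \<in> \<Lambda>" "m = F2.shadow \<psi>" using m by blast
        have "inv_into UNIV m = F2.shadow (inv\<^bsub>Aut F2.X\<^esub> \<psi>)"
          by (rule inv_unique_comp) (simp_all add: \<psi>(2) fun_eq_iff F2.shadow_inv[OF aut[OF \<psi>(1)]])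
        then show ?thesis using subgroup.m_inv_closed[OF sub \<psi>(1)] by blast
      qed
      show "\<not> swap m v" if "m \<in> F2.shadow ` \<Lambda>" "m v = v" for m v
        using that lattice_elliptic_even[OF \<Lambda>] by blast
      fix t assume t: "t \<in> coloured_translations"
      have "twist \<circ> t \<circ> inv_into UNIV twist \<in> twisted" using t unfolding twisted_def by blast
      from c'(2)[OF this]
      obtain m where m: "m \<in> F2.shadow ` \<Lambda>"
        "\<And>v. m (c' v) = c' ((twist \<circ> t \<circ> inv_into UNIV twist) v)" by blast
      then show "\<exists>m\<in>F2.shadow ` \<Lambda>. \<forall>v. m (c' (twist v)) = c' (twist (t v))"
        by (intro bexI[of _ m]) simp_all
    qed
  qed
qed


end
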